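(* Let $v \in L^{\infty}(\mathbb{R})$ with $v \geq 0$. For $L>0$ let $I=(-L/2,+L/2)$ and let $\Gamma_v(L)=\lambda_1(L)-\lambda_0(L)$ be the spectral gap of the Schrödinger operator $h_L=-\frac{\mathrm{d}^2}{\mathrm{d}x^2}+v$ on $L^2(I)$ with Neumann boundary conditions at $x=\pm L/2$. Then $$\Gamma_v(L) \geq \mathrm{e}^{-8L\|v\|_{L^1(I)}} \cdot \frac{\pi^2}{L^2}$$ holds for all $L>0$.
   Context: For $L>0$ and $I=(-L/2,+L/2)$, the operator $h_L=-\frac{\mathrm{d}^2}{\mathrm{d}x^2}+v$ with real potential $v\in L^\infty(\mathbb{R})$, $v\ge 0$ (restricted to $I$), and Neumann boundary conditions at $x=\pm L/2$ is self-adjoint on $L^2(I)$ with purely discrete spectrum. Its eigenvalues, counted with multiplicity, are denoted $\lambda_0(L)\leq \lambda_1(L)\leq \dots$. The spectral gap is $\Gamma_v(L):=\lambda_1(L)-\lambda_0(L)$. Here $\|v\|_{L^1(I)}=\int_I |v(x)|\,\mathrm{d}x$. *)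

theory Defs
  imports "HOL-Analysis.Analysis" "HOL-Library.Function_Algebras"
begin

definition essentially_bounded :: "(real \<Rightarrow> real) \<Rightarrow> bool" where
  "essentially_bounded v \<longleftrightarrow>
     v \<in> borel_measurable lebesgue \<and> (\<exists>C. AE x in lebesgue. \<bar>v x\<bar> \<le> C)"

definition square_integrable_on :: "real set \<Rightarrow> (real \<Rightarrow> complex) \<Rightarrow> bool" where
  "square_integrable_on A f \<longleftrightarrow>
     set_borel_measurable lebesgue A f \<and> set_integrable lebesgue A (\<lambda>x. (cmod (f x))\<^sup>2)"

text \<open>
  On a bounded interval, \<open>f\<close> lies in the Sobolev space \<open>H\<^sup>1(a,b)\<close> with derivative \<open>g\<close> iff
  \<open>f\<close> is absolutely continuous, i.e. the primitive of \<open>g\<close>, and \<open>g \<in> L\<^sup>2(a,b)\<close>.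
  The first argument is the representative that is continuous on the closed interval, so that
  boundary values make sense.
\<close>
definition has_H1_derivative ::
    "real \<Rightarrow> real \<Rightarrow> (real \<Rightarrow> complex) \<Rightarrow> (real \<Rightarrow> complex) \<Rightarrow> bool" where
  "has_H1_derivative a b f g \<longleftrightarrow>
     square_integrable_on {a..b} g \<and>
     (\<forall>x\<in>{a..b}. f x = f a + (LINT t:{a..x}|lebesgue. g t))"

text \<open>
  The graph of \<open>h\<^sub>L = - d\<^sup>2/dx\<^sup>2 + v\<close> with domain
  \<open>{f \<in> H\<^sup>2(-L/2, L/2). f'(-L/2) = f'(L/2) = 0}\<close>.  A domain element is represented
  by its continuous representative on the closed interval, set to \<open>0\<close> outside, so that
  distinct functions are distinct elements of \<open>L\<^sup>2\<close>.  The image \<open>h\<close> is given only up to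
  null sets.  As \<open>f'\<close> is itself a primitive, it is continuous on the closed interval and
  its boundary values are determined by \<open>f\<close>.
\<close>
definition neumann_schroedinger ::
    "(real \<Rightarrow> real) \<Rightarrow> real \<Rightarrow> (real \<Rightarrow> complex) \<Rightarrow> (real \<Rightarrow> complex) \<Rightarrow> bool" where
  "neumann_schroedinger v L f h \<longleftrightarrow>
     (\<forall>x. x \<notin> {-L/2..L/2} \<longrightarrow> f x = 0) \<and>
     (\<exists>f' f''. has_H1_derivative (-L/2) (L/2) f f' \<and>
               has_H1_derivative (-L/2) (L/2) f' f'' \<and>
               f' (-L/2) = 0 \<and> f' (L/2) = 0 \<and>
               (AE x in lebesgue. x \<in> {-L/2<..<L/2} \<longrightarrow>
                  h x = - f'' x + complex_of_real (v x) * f x))"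

text \<open>
  Only real \<open>\<mu>\<close> are considered: the operator is self-adjoint.
\<close>
definition eigenspace :: "(real \<Rightarrow> real) \<Rightarrow> real \<Rightarrow> real \<Rightarrow> (real \<Rightarrow> complex) set" where
  "eigenspace v L \<mu> = {f. neumann_schroedinger v L f (\<lambda>x. complex_of_real \<mu> * f x)}"

definition is_eigenvalue :: "(real \<Rightarrow> real) \<Rightarrow> real \<Rightarrow> real \<Rightarrow> bool" where
  "is_eigenvalue v L \<mu> \<longleftrightarrow> (\<exists>f\<in>eigenspace v L \<mu>. f \<noteq> 0)"

abbreviation scale_fun :: "complex \<Rightarrow> (real \<Rightarrow> complex) \<Rightarrow> real \<Rightarrow> complex" where
  "scale_fun c f \<equiv> (\<lambda>x. c * f x)"

lemma vector_space_scale_fun: "vector_space scale_fun"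
  by unfold_locales (auto simp: fun_eq_iff algebra_simps)

definition eigenvalue_multiplicity :: "(real \<Rightarrow> real) \<Rightarrow> real \<Rightarrow> real \<Rightarrow> nat" where
  "eigenvalue_multiplicity v L \<mu> = vector_space.dim scale_fun (eigenspace v L \<mu>)"

text \<open>
  The number of eigenvalues \<open>\<le> \<mu>\<close>, counted with multiplicity.  Since the spectrum is purely
  discrete and bounded below, the index set of this sum is finite.
\<close>
definition eigenvalue_count :: "(real \<Rightarrow> real) \<Rightarrow> real \<Rightarrow> real \<Rightarrow> nat" where
  "eigenvalue_count v L \<mu> =
     (\<Sum>l | is_eigenvalue v L l \<and> l \<le> \<mu>. eigenvalue_multiplicity v L l)"

text \<open>
  \<open>eigenvalue v L k\<close> is \<open>\<lambda>\<^sub>k(L)\<close> in the nondecreasing enumeration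
  \<open>\<lambda>\<^sub>0(L) \<le> \<lambda>\<^sub>1(L) \<le> \<dots>\<close> with multiplicity: the least \<open>\<mu>\<close> below or at which there are at
  least \<open>k + 1\<close> eigenvalues.
\<close>
definition eigenvalue :: "(real \<Rightarrow> real) \<Rightarrow> real \<Rightarrow> nat \<Rightarrow> real" where
  "eigenvalue v L k = Inf {\<mu>. k + 1 \<le> eigenvalue_count v L \<mu>}"

definition spectral_gap :: "(real \<Rightarrow> real) \<Rightarrow> real \<Rightarrow> real" where
  "spectral_gap v L = eigenvalue v L 1 - eigenvalue v L 0"

end

theory Submission
  imports Defs
begin

text \<open>
  Let \<open>U \<mu>\<close> solve \<open>- u'' + v u = \<mu> u\<close> with \<open>u a = 1\<close>, \<open>u' a = 0\<close>, and let \<open>Y \<mu> = (U \<mu>)'\<close>; the Neumann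
  eigenvalues are the zeros of \<open>\<mu> \<mapsto> Y \<mu> b\<close>, and they are simple.  The supremum \<open>E\<^sub>0\<close> of the \<open>\<mu>\<close> for which
  \<open>U \<mu> > 0\<close> and \<open>Y \<mu> b \<ge> 0\<close> is one of them, with positive eigenfunction \<open>\<phi>\<close>.  The Riccati equation
  \<open>z' = v - E\<^sub>0 - z\<^sup>2\<close> for \<open>z = \<phi>'/\<phi>\<close>, with \<open>z = 0\<close> at both ends, bounds \<open>\<bar>z\<bar>\<close> by the integral of \<open>v\<close> and
  hence the oscillation of \<open>ln \<phi>\<close>.  For \<open>\<mu> = E\<^sub>0 + \<Gamma>\<close>, \<open>\<Gamma> > 0\<close>, the quotient \<open>w = U \<mu> / \<phi>\<close> and the Wronskian
  \<open>p = \<phi> Y \<mu> - U \<mu> \<phi>'\<close> satisfy \<open>w' = p / \<phi>\<^sup>2\<close> and \<open>p' = - \<Gamma> \<phi>\<^sup>2 w\<close>, from which the potential has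
  disappeared.  Comparison with the case of constant \<open>\<phi>\<close> shows that \<open>p\<close> vanishes at a point of
  \<open>(a, b]\<close> only if \<open>\<Gamma> \<ge> (min \<phi>\<^sup>2 / max \<phi>\<^sup>2) \<pi>\<^sup>2 / (b - a)\<^sup>2\<close>, and that it does vanish if \<open>\<Gamma>\<close> is large; the
  least \<open>\<mu>\<close> with such a zero is the second eigenvalue.
\<close>

section \<open>Gronwall inequalities and primitives of integrable functions\<close>

lemma mvt_within:
  fixes f :: "real \<Rightarrow> real"
  assumes "a < b"
    and "\<And>x. x \<in> {a..b} \<Longrightarrow> (f has_real_derivative f' x) (at x within {a..b})"
  obtains \<xi> where "\<xi> \<in> {a<..<b}" "f b - f a = (b - a) * f' \<xi>"
proof -
  have "\<exists>\<xi>\<in>{a<..<b}. f b - f a = f' \<xi> * (b - a)"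
    using assms by (intro mvt_simple) (auto simp: has_field_derivative_def)
  then show thesis
    using that by (metis mult.commute)
qed

lemma nonpos_derivative_imp_le:
  fixes f :: "real \<Rightarrow> real"
  assumes "\<And>x. x \<in> {a..b} \<Longrightarrow> (f has_real_derivative f' x) (at x within {a..b})"
    and "\<And>x. x \<in> {a..b} \<Longrightarrow> f' x \<le> 0"
    and "a \<le> x" "x \<le> y" "y \<le> b"
  shows "f y \<le> f x"
proof (cases "x = y")
  case False
  then have "x < y"
    using assms(4) by simp
  moreover have "(f has_real_derivative f' t) (at t within {x..y})" if "t \<in> {x..y}" for t
    using that assms(3,5) by (intro DERIV_subset[OF assms(1)]) auto
  ultimately obtain \<xi> where "\<xi> \<in> {x<..<y}" "f y - f x = (y - x) * f' \<xi>"
    by (rule mvt_within)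
  then show ?thesis
    using assms(2)[of \<xi>] assms(3-5) mult_nonneg_nonpos[of "y - x" "f' \<xi>"] by auto
qed simp

text \<open>Multiplied by \<open>exp (- B * (t - a))\<close>, the right-hand side of the integral
  inequality is nonincreasing in \<open>t\<close>, since the inequality itself makes the derivative
  nonpositive.\<close>

lemma gronwall:
  fixes h :: "real \<Rightarrow> real"
  assumes "a \<le> x" "x \<le> b" and cont: "continuous_on {a..b} h" and "0 \<le> B"
    and le: "\<And>t. t \<in> {a..b} \<Longrightarrow> h t \<le> A + B * integral {a..t} h"
  shows "h x \<le> A * exp (B * (x - a))"
proof -
  define J where "J t = exp (- B * (t - a)) * (A + B * integral {a..t} h)" for t
  have "(J has_real_derivative exp (- B * (t - a)) * (B * (h t - (A + B * integral {a..t} h))))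
          (at t within {a..b})" if "t \<in> {a..b}" for t
    unfolding J_def
    by (auto intro!: derivative_eq_intros integral_has_real_derivative[OF cont that]
        simp: algebra_simps)
  moreover have "exp (- B * (t - a)) * (B * (h t - (A + B * integral {a..t} h))) \<le> 0"
    if "t \<in> {a..b}" for t
    using le[OF that] \<open>0 \<le> B\<close> by (simp add: mult_nonneg_nonpos)
  ultimately have "J x \<le> J a"
    using \<open>a \<le> x\<close> \<open>x \<le> b\<close>
    by (intro nonpos_derivative_imp_le[of a b J]) auto
  then have "exp (- B * (x - a)) * (A + B * integral {a..x} h) \<le> A"
    by (simp add: J_def)
  moreover have "exp (- B * (x - a)) * h x \<le> exp (- B * (x - a)) * (A + B * integral {a..x} h)"
    using le[of x] assms(1,2) by (intro mult_left_mono) auto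
  ultimately have "exp (- B * (x - a)) * h x \<le> A"
    by (rule order_trans[rotated])
  then have "exp (B * (x - a)) * (exp (- B * (x - a)) * h x) \<le> exp (B * (x - a)) * A"
    by (rule mult_left_mono) simp
  moreover have "exp (B * (x - a)) * exp (- B * (x - a)) = 1"
    by (simp flip: exp_add)
  ultimately show ?thesis
    by (metis mult.assoc mult.commute mult_1)
qed

text \<open>Reflection of \<open>gronwall\<close> under \<open>t \<mapsto> - t\<close>. It lets zero
  data at an interior point be propagated to the left.\<close>

lemma gronwall_backward:
  fixes h :: "real \<Rightarrow> real"
  assumes "a \<le> x" "x \<le> b" and cont: "continuous_on {a..b} h" and "0 \<le> B"
    and le: "\<And>t. t \<in> {a..b} \<Longrightarrow> h t \<le> A + B * integral {t..b} h"
  shows "h x \<le> A * exp (B * (b - x))"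
proof -
  let ?h = "\<lambda>t. h (- t)"
  have "continuous_on {-b..-a} ?h"
    by (rule continuous_on_compose2[OF cont]) (auto intro!: continuous_intros)
  moreover have "?h t \<le> A + B * integral {-b..t} ?h" if "t \<in> {-b..-a}" for t
    using le[of "-t"] that Henstock_Kurzweil_Integration.integral_reflect_real[where a = "-t" and b = b and f = h] by simp
  ultimately show ?thesis
    using gronwall[of "-b" "-x" "-a" ?h B A] assms(1,2,4) by simp
qed

text \<open>With a merely measurable potential, \<open>u'\<close> need not be differentiable
  everywhere, so differential equations are kept in integrated form. For continuous \<open>f\<close>
  this amounts to having the derivative \<open>f\<close> within the interval; lemmas below convert
  in both directions.\<close>

definition primitive_on :: "real \<Rightarrow> real \<Rightarrow> (real \<Rightarrow> 'a::euclidean_space) \<Rightarrow> (real \<Rightarrow> 'a) \<Rightarrow> bool"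
  where "primitive_on a b F f \<longleftrightarrow>
    f integrable_on {a..b} \<and> (\<forall>x\<in>{a..b}. F x - F a = integral {a..x} f)"

lemma primitive_on_eq:
  "primitive_on a b F f \<Longrightarrow> x \<in> {a..b} \<Longrightarrow> F x = F a + integral {a..x} f"
  unfolding primitive_on_def by (metis add.commute diff_add_cancel)

lemma primitive_on_integrable:
  "primitive_on a b F f \<Longrightarrow> a \<le> x \<Longrightarrow> z \<le> b \<Longrightarrow> f integrable_on {x..z}"
  unfolding primitive_on_def by (auto intro: integrable_subinterval_real)

lemma primitive_on_continuous:
  assumes "primitive_on a b F f"
  shows "continuous_on {a..b} F"
  using primitive_on_integrable[OF assms, of a b]
  by (subst continuous_on_cong[OF refl primitive_on_eq[OF assms]])
     (auto intro!: continuous_intros indefinite_integral_continuous_1)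

lemma primitive_on_diff:
  assumes "primitive_on a b F f" "a \<le> x" "x \<le> z" "z \<le> b"
  shows "F z - F x = integral {x..z} f"
proof -
  have "f integrable_on {a..z}"
    by (rule primitive_on_integrable[OF assms(1) order_refl assms(4)])
  then have "integral {a..x} f + integral {x..z} f = integral {a..z} f"
    by (rule Henstock_Kurzweil_Integration.integral_combine[OF assms(2,3)])
  moreover have "F x - F a = integral {a..x} f" "F z - F a = integral {a..z} f"
    using assms unfolding primitive_on_def by auto
  moreover have "F z - F x = (F z - F a) - (F x - F a)"
    by simp
  ultimately show ?thesis
    by (metis add_diff_cancel_left')
qed

lemma primitive_on_has_vector_derivative:
  assumes "primitive_on a b F f" "continuous_on {a..b} f" "x \<in> {a..b}"
  shows "(F has_vector_derivative f x) (at x within {a..b})"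
proof (rule has_vector_derivative_transform)
  show "((\<lambda>x. F a + integral {a..x} f) has_vector_derivative f x) (at x within {a..b})"
    using integral_has_vector_derivative[OF assms(2,3)] by (auto intro!: derivative_eq_intros)
  show "F z = F a + integral {a..z} f" if "z \<in> {a..b}" for z
    by (rule primitive_on_eq[OF assms(1) that])
qed fact

lemma primitive_on_has_real_derivative:
  assumes "primitive_on a b F f" "continuous_on {a..b} f" "x \<in> {a..b}"
  shows "(F has_real_derivative f x) (at x within {a..b})"
  using primitive_on_has_vector_derivative[OF assms]
  by (simp add: has_real_derivative_iff_has_vector_derivative)

lemma has_real_derivative_primitive_on:
  assumes "\<And>x. x \<in> {a..b} \<Longrightarrow> (F has_real_derivative f x) (at x within {a..b})"
    "continuous_on {a..b} f"
  shows "primitive_on a b F f"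
  unfolding primitive_on_def
proof (intro conjI ballI)
  show "f integrable_on {a..b}"
    by (rule integrable_continuous_real) fact
  fix x assume x: "x \<in> {a..b}"
  have "(f has_integral (F x - F a)) {a..x}"
  proof (rule fundamental_theorem_of_calculus)
    fix t assume t: "t \<in> {a..x}"
    have "(F has_real_derivative f t) (at t within {a..x})"
      using x t by (intro DERIV_subset[OF assms(1)]) auto
    then show "(F has_vector_derivative f t) (at t within {a..x})"
      by (simp add: has_real_derivative_iff_has_vector_derivative)
  qed (use x in simp)
  then show "F x - F a = integral {a..x} f"
    by (simp add: integral_unique)
qed

lemma primitive_on_cong:
  assumes "primitive_on a b F f" "\<And>x. x \<in> {a..b} \<Longrightarrow> F x = G x" "\<And>x. x \<in> {a..b} \<Longrightarrow> f x = g x"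
    "a \<le> b"
  shows "primitive_on a b G g"
  unfolding primitive_on_def
proof (intro conjI ballI)
  show "g integrable_on {a..b}"
    using assms(1,3) integrable_cong unfolding primitive_on_def by blast
  fix x assume x: "x \<in> {a..b}"
  then have "integral {a..x} f = integral {a..x} g"
    using assms(3) by (intro Henstock_Kurzweil_Integration.integral_cong) auto
  moreover have "F x - F a = integral {a..x} f"
    using assms(1) x unfolding primitive_on_def by blast
  ultimately show "G x - G a = integral {a..x} g"
    using assms(2)[OF x] assms(2)[of a] \<open>a \<le> b\<close> by simp
qed

lemma primitive_on_diff_primitive:
  assumes F: "primitive_on a b F f" and G: "primitive_on a b G g"
  shows "primitive_on a b (\<lambda>x. F x - G x) (\<lambda>x. f x - g x)"
  unfolding primitive_on_def
proof (intro conjI ballI)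
  show "(\<lambda>x. f x - g x) integrable_on {a..b}"
    using assms unfolding primitive_on_def by (auto intro!: integrable_diff)
  fix x assume x: "x \<in> {a..b}"
  then have "integral {a..x} (\<lambda>x. f x - g x) = integral {a..x} f - integral {a..x} g"
    using primitive_on_integrable[OF F, of a x] primitive_on_integrable[OF G, of a x]
    by (intro Henstock_Kurzweil_Integration.integral_diff) auto
  then show "F x - G x - (F a - G a) = integral {a..x} (\<lambda>x. f x - g x)"
    using primitive_on_eq[OF F x] primitive_on_eq[OF G x] by simp
qed

text \<open>The difference quotients at \<open>t\<close> are at most
  \<open>\<bar>K\<bar> * \<bar>s - t\<bar>\<close>, so the derivative vanishes everywhere.\<close>

lemma quadratic_increment_imp_const:
  fixes D :: "real \<Rightarrow> real"
  assumes "\<And>x z. a \<le> x \<Longrightarrow> x \<le> z \<Longrightarrow> z \<le> b \<Longrightarrow> \<bar>D z - D x\<bar> \<le> K * (z - x)\<^sup>2"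
    and "x \<in> {a..b}"
  shows "D x = D a"
proof -
  have "(D has_real_derivative 0) (at t within {a..b})" if t: "t \<in> {a..b}" for t
    unfolding has_field_derivative_iff
  proof (rule Lim_null_comparison)
    have "norm ((D s - D t) / (s - t)) \<le> \<bar>K\<bar> * \<bar>s - t\<bar>" if "s \<in> {a..b}" for s
    proof (cases "s = t")
      case False
      have "\<bar>D s - D t\<bar> \<le> K * (s - t)\<^sup>2"
        using assms(1)[of s t] assms(1)[of t s] t that
        by (cases "s \<le> t") (auto simp: abs_minus_commute power2_commute)
      also have "\<dots> \<le> \<bar>K\<bar> * \<bar>s - t\<bar> * \<bar>s - t\<bar>"
        by (simp add: power2_eq_square abs_mult_self_eq mult.assoc mult_right_mono)
      finally show ?thesis
        using False by (simp add: divide_le_eq)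
    qed simp
    then show "\<forall>\<^sub>F s in at t within {a..b}. norm ((D s - D t) / (s - t)) \<le> \<bar>K\<bar> * \<bar>s - t\<bar>"
      by (simp add: eventually_at_filter)
    show "((\<lambda>s. \<bar>K\<bar> * \<bar>s - t\<bar>) \<longlongrightarrow> 0) (at t within {a..b})"
      by (auto intro!: tendsto_eq_intros)
  qed
  then show ?thesis
    using has_field_derivative_zero_constant[of "{a..b}" D] assms(2)
    by (metis atLeastAtMost_iff convex_closed_interval order_refl order_trans)
qed

lemma continuous_on_Icc_bounded:
  fixes f :: "real \<Rightarrow> 'a::real_normed_vector"
  assumes "continuous_on {a..b} f"
  obtains M where "0 < M" "\<And>x. x \<in> {a..b} \<Longrightarrow> norm (f x) \<le> M"
proof -
  have "bounded (f ` {a..b})"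
    by (intro compact_imp_bounded compact_continuous_image assms compact_Icc)
  then show thesis
    using that by (auto simp: bounded_pos)
qed

text \<open>This gives meaning to the integral of \<open>q u\<close> in the integrated equation when
  \<open>q\<close> is only bounded and measurable.\<close>

lemma bounded_mult_continuous_integrable:
  fixes f :: "real \<Rightarrow> 'a::euclidean_space"
  assumes "q \<in> borel_measurable (lebesgue_on {a..b})"
    and "\<And>x. x \<in> {a..b} \<Longrightarrow> \<bar>q x\<bar> \<le> K" "continuous_on {a..b} f"
  shows "(\<lambda>x. q x *\<^sub>R f x) integrable_on {a..b}"
proof -
  obtain M where M: "0 < M" "\<And>x. x \<in> {a..b} \<Longrightarrow> norm (f x) \<le> M"
    using continuous_on_Icc_bounded[OF assms(3)] by blast
  have "(\<lambda>x. q x *\<^sub>R f x) \<in> borel_measurable (lebesgue_on {a..b})"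
    using assms(1) continuous_imp_measurable_on_sets_lebesgue[OF assms(3)] by auto
  moreover have "norm (q x *\<^sub>R f x) \<le> K * M" if "x \<in> {a..b}" for x
    unfolding norm_scaleR using assms(2)[OF that] M(2)[OF that] by (intro mult_mono') auto
  ultimately show ?thesis
    by (rule measurable_bounded_by_integrable_imp_integrable[OF _ integrable_const_ivl]) simp_all
qed

lemma primitive_on_lipschitz:
  assumes "primitive_on a b F f" "\<And>x. x \<in> {a..b} \<Longrightarrow> norm (f x) \<le> B"
    "a \<le> x" "x \<le> z" "z \<le> b"
  shows "norm (F z - F x) \<le> B * (z - x)"
proof -
  have "norm (integral {x..z} f) \<le> integral {x..z} (\<lambda>_. B)"
    using assms by (intro integral_norm_bound_integral primitive_on_integrable[OF assms(1)]) auto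
  then show ?thesis
    using primitive_on_diff[OF assms(1,3-5)] \<open>x \<le> z\<close> by (simp add: mult.commute)
qed

text \<open>
  \<open>g\<close> is only bounded and measurable, so \<open>G\<close> need not be differentiable everywhere.  The
  difference of the two sides has increments that are quadratic in the length of the interval,
  hence is constant.
\<close>
lemma primitive_on_mult:
  fixes F G :: "real \<Rightarrow> real"
  assumes F: "primitive_on a b F f" "continuous_on {a..b} f"
    and G: "primitive_on a b G g" "\<And>x. x \<in> {a..b} \<Longrightarrow> \<bar>g x\<bar> \<le> B"
  shows "primitive_on a b (\<lambda>x. F x * G x) (\<lambda>x. F x * g x + f x * G x)"
proof -
  let ?e = "\<lambda>x. F x * g x + f x * G x"
  obtain M where M: "0 < M" "\<And>x. x \<in> {a..b} \<Longrightarrow> \<bar>f x\<bar> \<le> M"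
    using continuous_on_Icc_bounded[OF F(2)] by auto
  have contF: "continuous_on {a..b} F" and contG: "continuous_on {a..b} G"
    using F G primitive_on_continuous by blast+
  have g_abs: "g absolutely_integrable_on {a..b}"
    using G by (intro absolutely_integrable_integrable_bound[where g = "\<lambda>_. B"])
      (auto simp: primitive_on_def)
  have "g \<in> borel_measurable (lebesgue_on {a..b})"
    using g_abs by (intro absolutely_integrable_imp_borel_measurable) auto
  then have int_Fg: "(\<lambda>x. F x * g x) integrable_on {a..b}"
    using bounded_mult_continuous_integrable[of g a b B F] G(2) contF by (simp add: mult.commute)
  then have int_e: "?e integrable_on {a..b}"
    using F(2) contG by (intro integrable_add[OF int_Fg] integrable_continuous_real continuous_intros)
  define D where "D x = F x * G x - integral {a..x} ?e" for x
  have D: "\<bar>D z - D x\<bar> \<le> 2 * M * B * (z - x)\<^sup>2" if "a \<le> x" "x \<le> z" "z \<le> b" for x z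
  proof -
    have sub: "{x..z} \<subseteq> {a..b}" using that by auto
    have ints: "?e integrable_on {x..z}" "g integrable_on {x..z}" "f integrable_on {x..z}"
      using int_e F(1) G(1) integrable_subinterval_real[OF _ sub] unfolding primitive_on_def by auto
    have "integral {a..x} ?e + integral {x..z} ?e = integral {a..z} ?e"
      using that by (intro Henstock_Kurzweil_Integration.integral_combine
          integrable_subinterval_real[OF int_e]) auto
    \<comment> \<open>Freezing \<open>F\<close> at the right end and \<open>G\<close> at the left
      end splits the increment of the product exactly. After subtracting \<open>?e\<close>, each
      product left in the integrand contains an increment of \<open>F\<close> or \<open>G\<close> of
      size at most a constant times \<open>z - x\<close>; integration contributes the second factor
      \<open>z - x\<close>.\<close>
    then have "D z - D x = F z * (G z - G x) + G x * (F z - F x) - integral {x..z} ?e"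
      by (simp add: D_def algebra_simps)
    also have "\<dots> = integral {x..z} (\<lambda>t. F z * g t + G x * f t - ?e t)"
    proof -
      have "integral {x..z} (\<lambda>t. F z * g t + G x * f t - ?e t)
        = integral {x..z} (\<lambda>t. F z * g t + G x * f t) - integral {x..z} ?e"
        by (rule Henstock_Kurzweil_Integration.integral_diff)
          (intro integrable_add integrable_on_mult_right ints)+
      also have "integral {x..z} (\<lambda>t. F z * g t + G x * f t)
        = integral {x..z} (\<lambda>t. F z * g t) + integral {x..z} (\<lambda>t. G x * f t)"
        by (rule Henstock_Kurzweil_Integration.integral_add) (intro integrable_on_mult_right ints)+
      finally show ?thesis
        using primitive_on_diff[OF F(1) that] primitive_on_diff[OF G(1) that] by simp
    qed
    finally have eq: "D z - D x = integral {x..z} (\<lambda>t. F z * g t + G x * f t - ?e t)" .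
    have "norm (integral {x..z} (\<lambda>t. F z * g t + G x * f t - ?e t))
      \<le> integral {x..z} (\<lambda>_. 2 * M * B * (z - x))"
    proof (rule integral_norm_bound_integral)
      show "(\<lambda>t. F z * g t + G x * f t - ?e t) integrable_on {x..z}"
        by (intro integrable_diff integrable_add integrable_on_mult_right ints)
      fix t assume t: "t \<in> {x..z}"
      have 1: "\<bar>F z - F t\<bar> \<le> M * (z - x)"
        using primitive_on_lipschitz[OF F(1), of M t z] M t that
        by (smt (verit) atLeastAtMost_iff mult_left_mono real_norm_def)
      have 2: "\<bar>G x - G t\<bar> \<le> B * (z - x)"
      proof -
        have "0 \<le> B" using G(2)[of t] t sub by (smt (verit) subsetD)
        then show ?thesis
          using primitive_on_lipschitz[OF G(1), of B x t] G(2) t that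
          by (smt (verit) atLeastAtMost_iff mult_left_mono real_norm_def)
      qed
      have 3: "\<bar>f t\<bar> \<le> M" "\<bar>g t\<bar> \<le> B"
        using M G(2) t sub by auto
      have "F z * g t + G x * f t - ?e t = (F z - F t) * g t + (G x - G t) * f t"
        by (simp add: algebra_simps)
      also have "\<bar>\<dots>\<bar> \<le> \<bar>F z - F t\<bar> * \<bar>g t\<bar> + \<bar>G x - G t\<bar> * \<bar>f t\<bar>"
        by (metis abs_mult abs_triangle_ineq)
      also have "\<dots> \<le> (M * (z - x)) * B + (B * (z - x)) * M"
        using 1 2 3 by (intro add_mono mult_mono) auto
      finally show "norm (F z * g t + G x * f t - ?e t) \<le> 2 * M * B * (z - x)"
        by (simp add: algebra_simps)
    qed auto
    then show ?thesis
      using eq that by (simp add: power2_eq_square algebra_simps)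
  qed
  show ?thesis
    unfolding primitive_on_def
  proof (intro conjI ballI int_e)
    fix x assume "x \<in> {a..b}"
    then have "D x = D a"
      using quadratic_increment_imp_const[of a b D] D by blast
    then show "F x * G x - F a * G a = integral {a..x} ?e"
      by (simp add: D_def)
  qed
qed

text \<open>The equation \<open>u'' = q u\<close> as a first-order system with
  \<open>y = u'\<close>. The value type is left general so that real shooting solutions and complex
  eigenfunctions share one uniqueness lemma.\<close>

definition solves :: "real \<Rightarrow> real \<Rightarrow> (real \<Rightarrow> real) \<Rightarrow> (real \<Rightarrow> 'a::euclidean_space) \<Rightarrow> (real \<Rightarrow> 'a) \<Rightarrow> bool"
  where "solves a b q u y \<longleftrightarrow> primitive_on a b u y \<and> primitive_on a b y (\<lambda>t. q t *\<^sub>R u t)"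

text \<open>Since \<open>q1 u1 - q2 u2 = q1 (u1 - u2) + (q1 - q2) u2\<close>, Gronwall applies to
  the sum of the norms of both differences; \<open>1 \<le> K\<close> lets one constant serve both
  components. The case \<epsilon> = 0 is uniqueness, small \<epsilon> is continuous dependence on
  the spectral parameter.\<close>

lemma solves_diff_bound:
  assumes s1: "solves a b q1 u1 y1" and s2: "solves a b q2 u2 y2"
    and init: "u1 a = u2 a" "y1 a = y2 a"
    and K: "\<And>x. x \<in> {a..b} \<Longrightarrow> \<bar>q1 x\<bar> \<le> K" "1 \<le> K"
    and \<epsilon>: "\<And>x. x \<in> {a..b} \<Longrightarrow> \<bar>q1 x - q2 x\<bar> \<le> \<epsilon>"
    and M: "\<And>x. x \<in> {a..b} \<Longrightarrow> norm (u2 x) \<le> M"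
    and x: "x \<in> {a..b}"
  shows "norm (u1 x - u2 x) + norm (y1 x - y2 x) \<le> \<epsilon> * M * (b - a) * exp (K * (b - a))"
proof -
  define d e where "d = (\<lambda>t. u1 t - u2 t)" and "e = (\<lambda>t. y1 t - y2 t)"
  have d: "primitive_on a b d e"
    and e: "primitive_on a b e (\<lambda>t. q1 t *\<^sub>R u1 t - q2 t *\<^sub>R u2 t)"
    using s1 s2 unfolding solves_def d_def e_def by (auto intro: primitive_on_diff_primitive)
  have cont: "continuous_on {a..b} d" "continuous_on {a..b} e"
    using d e primitive_on_continuous by blast+
  have "0 \<le> \<epsilon>" "0 \<le> M"
    using order_trans[OF abs_ge_zero \<epsilon>[OF x]] order_trans[OF norm_ge_zero M[OF x]] by auto
  define h where "h t = norm (d t) + norm (e t)" for t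
  have cont_h: "continuous_on {a..b} h"
    unfolding h_def by (intro continuous_intros cont)
  have "h t \<le> \<epsilon> * M * (b - a) + K * integral {a..t} h" if t: "t \<in> {a..b}" for t
  proof -
    have cont': "continuous_on {a..t} d" "continuous_on {a..t} e"
      using cont continuous_on_subset t by (metis atLeastatMost_subset_iff atLeastAtMost_iff order_refl)+
    have "d t = integral {a..t} e"
      using primitive_on_eq[OF d t] init by (simp add: d_def)
    then have "norm (d t) \<le> integral {a..t} (\<lambda>s. norm (e s))"
      using cont' by (auto intro!: integral_norm_bound_integral integrable_continuous_real continuous_intros)
    moreover have "e t = integral {a..t} (\<lambda>t. q1 t *\<^sub>R u1 t - q2 t *\<^sub>R u2 t)"
      using primitive_on_eq[OF e t] init by (simp add: e_def)
    then have "norm (e t) \<le> integral {a..t} (\<lambda>s. K * norm (d s) + \<epsilon> * M)"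
    proof (simp only:, intro integral_norm_bound_integral)
      fix s assume s: "s \<in> {a..t}"
      then have s': "s \<in> {a..b}" using t by auto
      have "q1 s *\<^sub>R u1 s - q2 s *\<^sub>R u2 s = q1 s *\<^sub>R d s + (q1 s - q2 s) *\<^sub>R u2 s"
        by (simp add: d_def algebra_simps)
      also have "norm \<dots> \<le> \<bar>q1 s\<bar> * norm (d s) + \<bar>q1 s - q2 s\<bar> * norm (u2 s)"
        by (metis norm_scaleR norm_triangle_ineq)
      also have "\<dots> \<le> K * norm (d s) + \<epsilon> * M"
        using K(1)[OF s'] \<epsilon>[OF s'] M[OF s'] \<open>0 \<le> \<epsilon>\<close>
        by (intro add_mono mult_mono) auto
      finally show "norm (q1 s *\<^sub>R u1 s - q2 s *\<^sub>R u2 s) \<le> K * norm (d s) + \<epsilon> * M" .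
    next
      show "(\<lambda>t. q1 t *\<^sub>R u1 t - q2 t *\<^sub>R u2 t) integrable_on {a..t}"
        using primitive_on_integrable[OF e, of a t] t by simp
    qed (use cont' in \<open>auto intro!: integrable_continuous_real continuous_intros\<close>)
    ultimately have "h t \<le> integral {a..t} (\<lambda>s. norm (e s)) + integral {a..t} (\<lambda>s. K * norm (d s) + \<epsilon> * M)"
      unfolding h_def by simp
    also have "\<dots> = integral {a..t} (\<lambda>s. norm (e s) + (K * norm (d s) + \<epsilon> * M))"
      using cont' by (intro Henstock_Kurzweil_Integration.integral_add[symmetric])
        (auto intro!: integrable_continuous_real continuous_intros)
    also have "\<dots> \<le> integral {a..t} (\<lambda>s. \<epsilon> * M + K * h s)"
    proof (rule integral_le)
      fix s
      have "norm (e s) \<le> K * norm (e s)"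
        using \<open>1 \<le> K\<close> mult_right_mono[of 1 K "norm (e s)"] by simp
      then show "norm (e s) + (K * norm (d s) + \<epsilon> * M) \<le> \<epsilon> * M + K * h s"
        by (simp add: h_def algebra_simps)
    qed (use cont' in \<open>auto simp: h_def intro!: integrable_continuous_real continuous_intros\<close>)
    also have "\<dots> = integral {a..t} (\<lambda>s. \<epsilon> * M) + integral {a..t} (\<lambda>s. K * h s)"
      using cont' by (intro Henstock_Kurzweil_Integration.integral_add)
        (auto simp: h_def intro!: integrable_continuous_real continuous_intros)
    also have "\<dots> = \<epsilon> * M * (t - a) + K * integral {a..t} h"
      using t by (simp add: mult.commute)
    also have "\<dots> \<le> \<epsilon> * M * (b - a) + K * integral {a..t} h"
      using t \<open>0 \<le> \<epsilon>\<close> \<open>0 \<le> M\<close> by (intro add_right_mono mult_left_mono) auto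
    finally show ?thesis .
  qed
  then have "h x \<le> \<epsilon> * M * (b - a) * exp (K * (x - a))"
    using x K(2) by (intro gronwall[OF _ _ cont_h]) auto
  also have "\<dots> \<le> \<epsilon> * M * (b - a) * exp (K * (b - a))"
    using x \<open>0 \<le> \<epsilon>\<close> \<open>0 \<le> M\<close> K(2) by (intro mult_left_mono) (auto intro!: mult_left_mono mult_nonneg_nonneg)
  finally show ?thesis
    by (simp add: h_def d_def e_def)
qed

lemma solves_unique:
  assumes "solves a b q u1 y1" "solves a b q u2 y2" "u1 a = u2 a" "y1 a = y2 a"
    and K: "\<And>x. x \<in> {a..b} \<Longrightarrow> \<bar>q x\<bar> \<le> K"
    and x: "x \<in> {a..b}"
  shows "u1 x = u2 x" "y1 x = y2 x"
proof -
  have "continuous_on {a..b} u2"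
    using assms(2) primitive_on_continuous unfolding solves_def by blast
  then obtain M where "\<And>x. x \<in> {a..b} \<Longrightarrow> norm (u2 x) \<le> M"
    using continuous_on_Icc_bounded by metis
  then have "norm (u1 x - u2 x) + norm (y1 x - y2 x) \<le> 0 * M * (b - a) * exp (max 1 K * (b - a))"
    using K x by (intro solves_diff_bound[OF assms(1-4)]) (auto simp: le_max_iff_disj)
  then have "norm (u1 x - u2 x) + norm (y1 x - y2 x) \<le> 0"
    by simp
  then have "norm (u1 x - u2 x) = 0" "norm (y1 x - y2 x) = 0"
    using norm_ge_zero[of "u1 x - u2 x"] norm_ge_zero[of "y1 x - y2 x"] by linarith+
  then show "u1 x = u2 x" "y1 x = y2 x"
    by simp_all
qed

text \<open>Backward Gronwall for \<open>norm (u t) + norm (y t)\<close>, which vanishes at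
  \<open>c\<close>. Applied to a solution with \<open>u a = 1\<close>, it shows that all zeros are
  simple.\<close>

lemma solves_zero_backward:
  assumes s: "solves a b q u y" and c: "c \<in> {a..b}" "u c = 0" "y c = 0"
    and K: "\<And>x. x \<in> {a..b} \<Longrightarrow> \<bar>q x\<bar> \<le> K"
  shows "u a = 0"
proof -
  define h where "h t = norm (u t) + norm (y t)" for t
  let ?K = "max 1 K"
  have u: "primitive_on a b u y" and y: "primitive_on a b y (\<lambda>t. q t *\<^sub>R u t)"
    using s unfolding solves_def by auto
  have "continuous_on {a..b} u" "continuous_on {a..b} y"
    using u y primitive_on_continuous by blast+
  then have cont: "continuous_on {t..c} u" "continuous_on {t..c} y" if "t \<in> {a..c}" for t
    using that c by (auto elim: continuous_on_subset)
  have "h t \<le> 0 + ?K * integral {t..c} h" if t: "t \<in> {a..c}" for t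
  proof -
    note [continuous_intros] = cont[OF t]
    have "- u t = integral {t..c} y"
      using primitive_on_diff[OF u, of t c] t c by simp
    then have "norm (u t) = norm (integral {t..c} y)"
      by (metis norm_minus_cancel)
    then have "norm (u t) \<le> integral {t..c} (\<lambda>s. norm (y s))"
      by (simp only:, intro integral_norm_bound_integral)
        (auto intro!: integrable_continuous_real continuous_intros)
    moreover have "- y t = integral {t..c} (\<lambda>s. q s *\<^sub>R u s)"
      using primitive_on_diff[OF y, of t c] t c by simp
    then have "norm (y t) = norm (integral {t..c} (\<lambda>s. q s *\<^sub>R u s))"
      by (metis norm_minus_cancel)
    then have "norm (y t) \<le> integral {t..c} (\<lambda>s. ?K * norm (u s))"
    proof (simp only:, intro integral_norm_bound_integral)
      show "(\<lambda>s. q s *\<^sub>R u s) integrable_on {t..c}"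
        using primitive_on_integrable[OF y, of t c] t c by simp
      fix s assume "s \<in> {t..c}"
      then show "norm (q s *\<^sub>R u s) \<le> ?K * norm (u s)"
        using K[of s] t c by (auto intro!: mult_right_mono)
    qed (auto intro!: integrable_continuous_real continuous_intros)
    ultimately have "h t \<le> integral {t..c} (\<lambda>s. norm (y s)) + integral {t..c} (\<lambda>s. ?K * norm (u s))"
      unfolding h_def by simp
    also have "\<dots> = integral {t..c} (\<lambda>s. norm (y s) + ?K * norm (u s))"
      by (intro Henstock_Kurzweil_Integration.integral_add[symmetric])
        (auto intro!: integrable_continuous_real continuous_intros)
    also have "\<dots> \<le> integral {t..c} (\<lambda>s. ?K * h s)"
    proof (rule integral_le)
      fix s
      have "norm (y s) \<le> ?K * norm (y s)"
        using mult_right_mono[of 1 ?K "norm (y s)"] by simp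
      then show "norm (y s) + ?K * norm (u s) \<le> ?K * h s"
        unfolding h_def by (simp add: distrib_left)
    qed (auto simp: h_def intro!: integrable_continuous_real continuous_intros)
    finally show ?thesis by simp
  qed
  moreover have "continuous_on {a..c} h"
    unfolding h_def using c cont[of a] by (auto intro!: continuous_intros)
  ultimately have "h a \<le> 0 * exp (?K * (c - a))"
    using c by (intro gronwall_backward) auto
  then have "norm (u a) = 0"
    using norm_ge_zero[of "u a"] norm_ge_zero[of "y a"] unfolding h_def by linarith
  then show ?thesis
    by simp
qed

section \<open>Existence of solutions by Picard iteration\<close>

lemma has_real_derivative_power_fact:
  "((\<lambda>x. (K * (x - a)) ^ Suc n / fact (Suc n)) has_real_derivative K * ((K * (x - a)) ^ n / fact n))
     (at x within S)"
proof -
  have "((\<lambda>x. K * (x - a)) has_real_derivative K) (at x within S)"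
    by (auto intro!: derivative_eq_intros)
  from DERIV_cdivide[OF DERIV_power_Suc[OF this], of n "fact (Suc n)"] show ?thesis
    by (simp add: fact_Suc del: power_Suc)
qed

lemma integral_power_fact:
  assumes "a \<le> (x::real)"
  shows "integral {a..x} (\<lambda>t. K * ((K * (t - a)) ^ n / fact n)) = (K * (x - a)) ^ Suc n / fact (Suc n)"
proof (rule integral_unique)
  show "((\<lambda>t. K * ((K * (t - a)) ^ n / fact n)) has_integral (K * (x - a)) ^ Suc n / fact (Suc n)) {a..x}"
    using fundamental_theorem_of_calculus[OF assms, of "\<lambda>x. (K * (x - a)) ^ Suc n / fact (Suc n)"]
      has_real_derivative_power_fact[of K a n]
    by (simp add: has_real_derivative_iff_has_vector_derivative)
qed

lemma sum_power_fact_le_exp: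
  assumes "0 \<le> (x::real)"
  shows "(\<Sum>n<N. x ^ n / fact n) \<le> exp x"
proof -
  have "(\<Sum>n<N. x ^ n /\<^sub>R fact n) \<le> exp x"
    unfolding exp_def using assms by (intro sum_le_suminf summable_exp_generic) auto
  then show ?thesis
    by (simp add: divide_inverse mult.commute)
qed

text \<open>The single terms of the Picard series, not its partial sums: the integral operator of
  the system is iterated on the initial data \<open>(1, 0)\<close>, and the solution is the sum over
  \<open>n\<close>.\<close>

primrec picard_series :: "real \<Rightarrow> (real \<Rightarrow> real) \<Rightarrow> nat \<Rightarrow> (real \<Rightarrow> real) \<times> (real \<Rightarrow> real)" where
  "picard_series a q 0 = ((\<lambda>x. 1), (\<lambda>x. 0))"
| "picard_series a q (Suc n) =
    ((\<lambda>x. integral {a..x} (snd (picard_series a q n))),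
     (\<lambda>x. integral {a..x} (\<lambda>t. q t * fst (picard_series a q n) t)))"

text \<open>The \<open>n\<close>-th terms are bounded by \<open>(M * (x - a)) ^ n / fact n\<close>.
  Hence the series converge pointwise and their partial sums stay below the constant
  \<open>E\<close>, so dominated convergence passes to the limit under the integrals.\<close>

lemma solves_exists:
  fixes q :: "real \<Rightarrow> real"
  assumes "a \<le> b" and q: "q \<in> borel_measurable (lebesgue_on {a..b})"
    and K: "\<And>x. x \<in> {a..b} \<Longrightarrow> \<bar>q x\<bar> \<le> K"
  shows "\<exists>u y. solves a b q u y \<and> u a = 1 \<and> y a = (0::real)"
proof -
  define M where "M = max 1 K"
  have M: "1 \<le> M" "\<And>x. x \<in> {a..b} \<Longrightarrow> \<bar>q x\<bar> \<le> M"
    using K by (auto simp: M_def le_max_iff_disj)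
  define U where "U n = fst (picard_series a q n)" for n
  define Y where "Y n = snd (picard_series a q n)" for n
  have U0: "U 0 = (\<lambda>x. 1)" and Y0: "Y 0 = (\<lambda>x. 0)"
    and USuc: "U (Suc n) = (\<lambda>x. integral {a..x} (Y n))"
    and YSuc: "Y (Suc n) = (\<lambda>x. integral {a..x} (\<lambda>t. q t * U n t))" for n
    by (auto simp: U_def Y_def)
  have int_q: "(\<lambda>t. q t * f t) integrable_on {a..x}" if "continuous_on {a..b} f" "x \<in> {a..b}" for f x
    using bounded_mult_continuous_integrable[OF q K that(1)] that(2)
    by (auto intro: integrable_subinterval_real)
  have cont: "continuous_on {a..b} (U n) \<and> continuous_on {a..b} (Y n)" for n
  proof (induction n)
    case (Suc n)
    then show ?case
      unfolding USuc YSuc using \<open>a \<le> b\<close> int_q[of "U n" b]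
      by (auto intro!: indefinite_integral_continuous_1 integrable_continuous_real)
  qed (simp add: U0 Y0)
  have cont': "continuous_on {a..x} (U n)" "continuous_on {a..x} (Y n)" if "x \<in> {a..b}" for n x
    using that cont[of n] by (auto elim: continuous_on_subset)
  have bound: "\<bar>U n x\<bar> \<le> (M * (x - a)) ^ n / fact n \<and> \<bar>Y n x\<bar> \<le> (M * (x - a)) ^ n / fact n"
    if "x \<in> {a..b}" for n x
    using that
  proof (induction n arbitrary: x)
    case (Suc n)
    have x: "x \<in> {a..b}" "\<And>t. t \<in> {a..x} \<Longrightarrow> t \<in> {a..b}" using Suc.prems by auto
    let ?g = "\<lambda>t. M * ((M * (t - a)) ^ n / fact n)"
    have g: "?g integrable_on {a..x}"
      by (intro integrable_continuous_real continuous_intros) auto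
    have "norm (integral {a..x} (Y n)) \<le> integral {a..x} ?g"
    proof (rule integral_norm_bound_integral[OF _ g])
      show "Y n integrable_on {a..x}"
        by (intro integrable_continuous_real cont' x)
      fix t assume t: "t \<in> {a..x}"
      have "1 * \<bar>Y n t\<bar> \<le> ?g t"
        using Suc.IH[OF x(2)[OF t]] M(1) by (intro mult_mono) auto
      then show "norm (Y n t) \<le> ?g t" by simp
    qed
    moreover have "norm (integral {a..x} (\<lambda>t. q t * U n t)) \<le> integral {a..x} ?g"
    proof (rule integral_norm_bound_integral[OF _ g])
      show "(\<lambda>t. q t * U n t) integrable_on {a..x}"
        using cont[of n] x by (intro int_q) auto
      fix t assume t: "t \<in> {a..x}"
      have "\<bar>q t\<bar> * \<bar>U n t\<bar> \<le> ?g t"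
        using Suc.IH[OF x(2)[OF t]] M(1) M(2)[OF x(2)[OF t]] by (intro mult_mono) auto
      then show "norm (q t * U n t) \<le> ?g t" by (simp add: abs_mult)
    qed
    ultimately show ?case
      using x(1) integral_power_fact[of a x M n] by (simp add: USuc YSuc)
  qed (simp add: U0 Y0)
  define E where "E = exp (M * (b - a))"
  have term_le: "(M * (x - a)) ^ n / fact n \<le> (M * (b - a)) ^ n / fact n" if "x \<in> {a..b}" for n x
    using that M by (intro divide_right_mono power_mono mult_left_mono) auto
  define SU where "SU N x = (\<Sum>n<N. U n x)" for N x
  define SY where "SY N x = (\<Sum>n<N. Y n x)" for N x
  have partial_bound: "\<bar>SU N x\<bar> \<le> E \<and> \<bar>SY N x\<bar> \<le> E" if x: "x \<in> {a..b}" for N x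
  proof -
    have "\<bar>\<Sum>n<N. f n x\<bar> \<le> E" if "\<And>n. \<bar>f n x\<bar> \<le> (M * (x - a)) ^ n / fact n" for f
    proof -
      have "\<bar>\<Sum>n<N. f n x\<bar> \<le> (\<Sum>n<N. (M * (b - a)) ^ n / fact n)"
        by (intro order_trans[OF sum_abs] sum_mono order_trans[OF that term_le[OF x]])
      also have "\<dots> \<le> E"
        unfolding E_def using M \<open>a \<le> b\<close> by (intro sum_power_fact_le_exp) auto
      finally show ?thesis .
    qed
    then show ?thesis
      using bound[OF x] unfolding SU_def SY_def by blast
  qed
  define u where "u x = (\<Sum>n. U n x)" for x
  define y where "y x = (\<Sum>n. Y n x)" for x
  have lim: "(\<lambda>N. SU N x) \<longlonglongrightarrow> u x \<and> (\<lambda>N. SY N x) \<longlonglongrightarrow> y x" if x: "x \<in> {a..b}" for x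
  proof -
    have "summable (\<lambda>n. (M * (x - a)) ^ n / fact n)"
      using summable_exp[of "M * (x - a)"] by (simp add: divide_inverse mult.commute)
    then have "summable (\<lambda>n. U n x)" "summable (\<lambda>n. Y n x)"
      using bound[OF x] by (auto intro: summable_comparison_test')
    then show ?thesis
      unfolding SU_def SY_def u_def y_def by (auto intro: summable_LIMSEQ)
  qed
  have contS: "continuous_on {a..b} (SU N)" "continuous_on {a..b} (SY N)" for N
    unfolding SU_def SY_def using cont by (auto intro!: continuous_intros)
  \<comment> \<open>Splitting off the term of index 0 and shifting the rest shows that the partial
    sums satisfy the Picard recursion, whose limit is the integral equation.\<close>
  have SU_Suc: "SU (Suc N) x = 1 + integral {a..x} (SY N)" if x: "x \<in> {a..b}" for N x
    unfolding SU_def SY_def sum.lessThan_Suc_shift U0 USuc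
    by (subst integral_sum) (auto intro!: integrable_continuous_real cont' x)
  have SY_Suc: "SY (Suc N) x = integral {a..x} (\<lambda>t. q t * SU N t)" if x: "x \<in> {a..b}" for N x
    unfolding SU_def SY_def sum.lessThan_Suc_shift Y0 YSuc sum_distrib_left
    using cont x by (subst integral_sum) (auto intro!: int_q)
  have y_dc: "y integrable_on {a..x}" "(\<lambda>N. integral {a..x} (SY N)) \<longlonglongrightarrow> integral {a..x} y"
    if x: "x \<in> {a..b}" for x
  proof -
    have 1: "SY k integrable_on {a..x}" for k
      using x by (intro integrable_continuous_real continuous_on_subset[OF contS(2)]) auto
    have 2: "norm (SY k t) \<le> E" if "t \<in> {a..x}" for k t
      using partial_bound[of t] x that by auto
    have 3: "(\<lambda>k. SY k t) \<longlonglongrightarrow> y t" if "t \<in> {a..x}" for t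
      using lim[of t] x that by auto
    show "y integrable_on {a..x}" "(\<lambda>N. integral {a..x} (SY N)) \<longlonglongrightarrow> integral {a..x} y"
      by (rule dominated_convergence[OF 1 integrable_const_ivl 2 3]; assumption)+
  qed
  have u_dc: "(\<lambda>t. q t * u t) integrable_on {a..x}"
    "(\<lambda>N. integral {a..x} (\<lambda>t. q t * SU N t)) \<longlonglongrightarrow> integral {a..x} (\<lambda>t. q t * u t)"
    if x: "x \<in> {a..b}" for x
  proof -
    have sub: "t \<in> {a..b}" if "t \<in> {a..x}" for t
      using that x by auto
    have 1: "(\<lambda>t. q t * SU k t) integrable_on {a..x}" for k
      by (rule int_q[OF contS(1) x])
    have 2: "norm (q t * SU k t) \<le> M * E" if "t \<in> {a..x}" for k t
      unfolding real_norm_def abs_mult using M(1) M(2)[OF sub[OF that]] partial_bound[OF sub[OF that]]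
      by (intro mult_mono) auto
    have 3: "(\<lambda>k. q t * SU k t) \<longlonglongrightarrow> q t * u t" if "t \<in> {a..x}" for t
      using lim[OF sub[OF that]] by (auto intro: tendsto_mult_left)
    show "(\<lambda>t. q t * u t) integrable_on {a..x}"
      "(\<lambda>N. integral {a..x} (\<lambda>t. q t * SU N t)) \<longlonglongrightarrow> integral {a..x} (\<lambda>t. q t * u t)"
      by (rule dominated_convergence[OF 1 integrable_const_ivl 2 3]; assumption)+
  qed
  have u_eq: "u x = 1 + integral {a..x} y" if x: "x \<in> {a..b}" for x
  proof (rule LIMSEQ_unique)
    show "(\<lambda>N. SU (Suc N) x) \<longlonglongrightarrow> u x"
      using lim[OF x] by (auto intro: LIMSEQ_Suc)
    show "(\<lambda>N. SU (Suc N) x) \<longlonglongrightarrow> 1 + integral {a..x} y"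
      unfolding SU_Suc[OF x] by (intro tendsto_intros y_dc x)
  qed
  have y_eq: "y x = integral {a..x} (\<lambda>t. q t * u t)" if x: "x \<in> {a..b}" for x
  proof (rule LIMSEQ_unique)
    show "(\<lambda>N. SY (Suc N) x) \<longlonglongrightarrow> y x"
      using lim[OF x] by (auto intro: LIMSEQ_Suc)
    show "(\<lambda>N. SY (Suc N) x) \<longlonglongrightarrow> integral {a..x} (\<lambda>t. q t * u t)"
      unfolding SY_Suc[OF x] by (intro u_dc x)
  qed
  have "solves a b q u y" "u a = 1" "y a = 0"
    using u_eq y_eq y_dc(1) u_dc(1) \<open>a \<le> b\<close> by (auto simp: solves_def primitive_on_def)
  then show ?thesis
    by blast
qed

section \<open>Comparison for Sturm systems\<close>

text \<open>
  \<open>- \<kappa> tan (\<kappa> (x - (a + c) / 2))\<close> with \<open>\<kappa> < \<pi> / (c - a)\<close> is the logarithmic derivative of a comparison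
  function without zeros in \<open>[a, c]\<close>; completing the square with it makes \<open>H\<close> increasing.
\<close>
lemma sturm_first_zero_lower_bound:
  fixes w p r :: "real \<Rightarrow> real"
  assumes "a < c" "0 < m" "0 < \<Gamma>"
    and r: "\<And>x. x \<in> {a..c} \<Longrightarrow> m \<le> r x" "\<And>x. x \<in> {a..c} \<Longrightarrow> r x \<le> M"
    and w: "\<And>x. x \<in> {a..c} \<Longrightarrow> (w has_real_derivative p x / r x) (at x within {a..c})"
    and p: "\<And>x. x \<in> {a..c} \<Longrightarrow> (p has_real_derivative - \<Gamma> * r x * w x) (at x within {a..c})"
    and ends: "p a = 0" "p c = 0"
    and nontriv: "\<And>x. x \<in> {a..c} \<Longrightarrow> w x = 0 \<Longrightarrow> p x \<noteq> 0"
  shows "m / M * (pi / (c - a))\<^sup>2 \<le> \<Gamma>"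
proof (rule ccontr)
  assume neg: "\<not> ?thesis"
  have "0 < M"
    using r[of a] assms(1,2) by auto
  have "\<Gamma> * M / m < Q" if "\<not> m / M * Q \<le> \<Gamma>" for Q
    using that \<open>0 < m\<close> \<open>0 < M\<close> by (simp add: field_simps)
  from this[OF neg] have "\<Gamma> * M / m < (pi / (c - a))\<^sup>2" .
  then have "sqrt (\<Gamma> * M / m) < pi / (c - a)"
    using \<open>a < c\<close> by (intro real_less_lsqrt) auto
  \<comment> \<open>The lower bound on \<kappa> makes the coefficient of
    \<open>(p x)\<^sup>2\<close> in \<open>H'\<close> positive, the upper bound keeps the argument
    of the tangent inside \<open>(- pi / 2, pi / 2)\<close>.\<close>
  then obtain \<kappa> where \<kappa>: "sqrt (\<Gamma> * M / m) < \<kappa>" "\<kappa> < pi / (c - a)"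
    using dense by blast
  have "0 < \<Gamma> * M / m"
    using assms \<open>0 < M\<close> by simp
  then have "0 < \<kappa>"
    using \<kappa>(1) real_sqrt_gt_zero order.strict_trans by blast
  then have "sqrt (\<Gamma> * M / m) < sqrt (\<kappa>\<^sup>2)"
    using \<kappa>(1) by simp
  then have \<kappa>2: "\<Gamma> * M / m < \<kappa>\<^sup>2"
    by (simp only: real_sqrt_less_iff)
  define s where "s x = \<kappa> * (x - (a + c) / 2)" for x
  have cos_s: "cos (s x) \<noteq> 0" if "x \<in> {a..c}" for x
  proof -
    have "\<kappa> * \<bar>x - (a + c) / 2\<bar> \<le> \<kappa> * ((c - a) / 2)"
      using that \<open>0 < \<kappa>\<close> by (intro mult_left_mono) (auto simp: abs_le_iff field_simps)
    also have "\<dots> < pi / 2"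
      using \<kappa>(2) \<open>a < c\<close> by (simp add: field_simps)
    finally have "\<bar>s x\<bar> < pi / 2"
      using \<open>0 < \<kappa>\<close> by (simp add: s_def abs_mult)
    then have "- (pi / 2) < s x" "s x < pi / 2"
      by linarith+
    then show ?thesis
      using cos_gt_zero_pi[of "s x"] by auto
  qed
  define H where "H x = \<kappa> * (p x)\<^sup>2 * tan (s x) - \<Gamma> * M * (p x * w x)" for x
  define H' where "H' x = (\<kappa> * p x * tan (s x) - \<Gamma> * r x * w x)\<^sup>2
    + \<Gamma>\<^sup>2 * r x * (w x)\<^sup>2 * (M - r x) + (p x)\<^sup>2 * (\<kappa>\<^sup>2 - \<Gamma> * M / r x)" for x
  have "(H has_real_derivative H' x) (at x within {a..c})" if x: "x \<in> {a..c}" for x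
  proof -
    have "(s has_real_derivative \<kappa>) (at x within {a..c})"
      unfolding s_def by (auto intro!: derivative_eq_intros)
    then have T: "((\<lambda>x. tan (s x)) has_real_derivative (1 + (tan (s x))\<^sup>2) * \<kappa>) (at x within {a..c})"
      using DERIV_chain'[of s \<kappa> x "{a..c}" tan, OF _ DERIV_tan[OF cos_s[OF x]]]
      by (simp add: tan_sec[OF cos_s[OF x]] power_inverse)
    have "r x \<noteq> 0"
      using r(1)[OF x] \<open>0 < m\<close> by simp
    show ?thesis
      unfolding H_def
      by (rule derivative_eq_intros T p[OF x] w[OF x] refl)+
        (use \<open>r x \<noteq> 0\<close> in \<open>simp add: H'_def field_simps power2_eq_square\<close>)
  qed
  \<comment> \<open>As \<open>p\<close> vanishes at both ends, so does \<open>H\<close>. At the mean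
    value point the three nonnegative summands of \<open>H'\<close> must all vanish, which forces
    \<open>p\<close> and \<open>w\<close> to vanish together.\<close>
  then obtain \<xi> where \<xi>: "\<xi> \<in> {a<..<c}" "H c - H a = (c - a) * H' \<xi>"
    using mvt_within[OF \<open>a < c\<close>] by blast
  then have "H' \<xi> = 0"
    using ends \<open>a < c\<close> by (simp add: H_def)
  have x: "\<xi> \<in> {a..c}"
    using \<xi>(1) by simp
  have "\<Gamma> * M / r \<xi> \<le> \<Gamma> * M / m"
    using r(1)[OF x] \<open>0 < m\<close> \<open>0 < M\<close> \<open>0 < \<Gamma>\<close> by (intro divide_left_mono) auto
  then have pos: "0 < \<kappa>\<^sup>2 - \<Gamma> * M / r \<xi>"
    using \<kappa>2 by simp
  have "0 \<le> \<Gamma>\<^sup>2 * r \<xi> * (w \<xi>)\<^sup>2 * (M - r \<xi>)"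
    using r[OF x] \<open>0 < m\<close> by (intro mult_nonneg_nonneg) auto
  moreover have "0 \<le> (p \<xi>)\<^sup>2 * (\<kappa>\<^sup>2 - \<Gamma> * M / r \<xi>)"
    using pos by (intro mult_nonneg_nonneg) auto
  ultimately have "(p \<xi>)\<^sup>2 * (\<kappa>\<^sup>2 - \<Gamma> * M / r \<xi>) = 0"
    and sq: "(\<kappa> * p \<xi> * tan (s \<xi>) - \<Gamma> * r \<xi> * w \<xi>)\<^sup>2 = 0"
    using \<open>H' \<xi> = 0\<close> zero_le_power2[of "\<kappa> * p \<xi> * tan (s \<xi>) - \<Gamma> * r \<xi> * w \<xi>"]
    unfolding H'_def by linarith+
  then have "p \<xi> = 0"
    using pos by simp
  moreover from sq this have "w \<xi> = 0"
    using r(1)[OF x] \<open>0 < m\<close> \<open>0 < \<Gamma>\<close> by simp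
  ultimately show False
    using nontriv[OF x] by simp
qed

text \<open>
  As long as \<open>p\<close> has no zero, the angle \<open>arctan (k w / p)\<close> increases at speed at least \<open>k / M\<close> and
  stays within a range of length \<open>\<pi>\<close>.
\<close>
lemma sturm_no_zero_upper_bound:
  fixes w p r :: "real \<Rightarrow> real"
  assumes "c < d" "0 < m" "0 < \<Gamma>"
    and r: "\<And>x. x \<in> {c..d} \<Longrightarrow> m \<le> r x" "\<And>x. x \<in> {c..d} \<Longrightarrow> r x \<le> M"
    and w: "\<And>x. x \<in> {c..d} \<Longrightarrow> (w has_real_derivative p x / r x) (at x within {c..d})"
    and p: "\<And>x. x \<in> {c..d} \<Longrightarrow> (p has_real_derivative - \<Gamma> * r x * w x) (at x within {c..d})"
    and nz: "\<And>x. x \<in> {c..d} \<Longrightarrow> p x \<noteq> 0"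
  shows "\<Gamma> < M / m * (pi / (d - c))\<^sup>2"
proof -
  have "0 < M"
    using r[of c] assms(1,2) by auto
  \<comment> \<open>With this \<open>k\<close>, the lower bounds \<open>1 / M\<close> and
    \<open>\<Gamma> * m\<close> of the coefficients of \<open>(p x)\<^sup>2\<close> and
    \<open>(w x)\<^sup>2\<close> have the ratio \<open>1 : k\<^sup>2\<close> of the denominator of
    \<open>\<theta>'\<close>, so the quotient is at least \<open>k / M\<close>.\<close>
  define k where "k = sqrt (\<Gamma> * m * M)"
  have "0 < k" and k2: "k\<^sup>2 = \<Gamma> * m * M"
    using assms(2,3) \<open>0 < M\<close> by (simp_all add: k_def)
  define \<theta>' where "\<theta>' x = k * ((p x)\<^sup>2 / r x + \<Gamma> * r x * (w x)\<^sup>2) / ((p x)\<^sup>2 + k\<^sup>2 * (w x)\<^sup>2)" for x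
  have "((\<lambda>x. arctan (k * (w x / p x))) has_real_derivative \<theta>' x) (at x within {c..d})"
    if x: "x \<in> {c..d}" for x
  proof -
    have "r x \<noteq> 0"
      using r(1)[OF x] \<open>0 < m\<close> by simp
    have "0 < (p x)\<^sup>2 + k\<^sup>2 * (w x)\<^sup>2"
      using nz[OF x] by (intro add_pos_nonneg) auto
    then have nz': "(p x)\<^sup>2 + k\<^sup>2 * (w x)\<^sup>2 \<noteq> 0" by simp
    let ?g = "\<lambda>x. k * (w x / p x)"
    let ?D = "k * ((p x)\<^sup>2 / r x + \<Gamma> * r x * (w x)\<^sup>2) / (p x)\<^sup>2"
    have "(?g has_real_derivative ?D) (at x within {c..d})"
      by (rule derivative_eq_intros p[OF x] w[OF x] refl nz[OF x])+
        (use \<open>r x \<noteq> 0\<close> nz[OF x] in \<open>simp add: field_simps power2_eq_square\<close>)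
    from DERIV_chain'[of ?g ?D x "{c..d}" arctan, OF this DERIV_arctan]
    have "((\<lambda>x. arctan (k * (w x / p x))) has_real_derivative
        inverse (1 + (k * (w x / p x))\<^sup>2) * ?D) (at x within {c..d})" .
    also have "inverse (1 + (k * (w x / p x))\<^sup>2) = (p x)\<^sup>2 / ((p x)\<^sup>2 + k\<^sup>2 * (w x)\<^sup>2)"
      using nz[OF x] nz' by (simp add: field_simps power_mult_distrib power_divide)
    also have "\<dots> * ?D = \<theta>' x"
      using nz[OF x] nz' by (simp add: \<theta>'_def)
    finally show ?thesis .
  qed
  then obtain \<xi> where \<xi>: "\<xi> \<in> {c<..<d}"
    "arctan (k * (w d / p d)) - arctan (k * (w c / p c)) = (d - c) * \<theta>' \<xi>"
    using mvt_within[OF \<open>c < d\<close>, of "\<lambda>x. arctan (k * (w x / p x))" \<theta>'] by blast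
  then have x: "\<xi> \<in> {c..d}" by simp
  have r\<xi>: "0 < r \<xi>" "r \<xi> \<le> M" "m \<le> r \<xi>"
    using r[OF x] \<open>0 < m\<close> by auto
  have "(p \<xi>)\<^sup>2 \<noteq> 0" using nz[OF x] by simp
  then have den: "0 < (p \<xi>)\<^sup>2 + k\<^sup>2 * (w \<xi>)\<^sup>2"
    by (intro add_pos_nonneg) auto
  have "((p \<xi>)\<^sup>2 + k\<^sup>2 * (w \<xi>)\<^sup>2) / M = (p \<xi>)\<^sup>2 / M + \<Gamma> * m * (w \<xi>)\<^sup>2"
    using \<open>0 < M\<close> by (simp add: k2 field_simps)
  also have "\<dots> \<le> (p \<xi>)\<^sup>2 / r \<xi> + \<Gamma> * r \<xi> * (w \<xi>)\<^sup>2"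
    using r\<xi> \<open>0 < \<Gamma>\<close> \<open>0 < M\<close> by (intro add_mono divide_left_mono mult_right_mono mult_left_mono) auto
  finally have "k * (((p \<xi>)\<^sup>2 + k\<^sup>2 * (w \<xi>)\<^sup>2) / M) / ((p \<xi>)\<^sup>2 + k\<^sup>2 * (w \<xi>)\<^sup>2) \<le> \<theta>' \<xi>"
    unfolding \<theta>'_def using den \<open>0 < k\<close> by (intro divide_right_mono mult_left_mono) auto
  then have "k / M \<le> \<theta>' \<xi>"
    using den by simp
  then have "(d - c) * (k / M) \<le> (d - c) * \<theta>' \<xi>"
    using \<open>c < d\<close> by (intro mult_left_mono) auto
  also have "\<dots> < pi"
    unfolding \<xi>(2)[symmetric]
    using arctan_bounded[of "k * (w d / p d)"] arctan_bounded[of "k * (w c / p c)"] by simp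
  finally have "k / M < pi / (d - c)"
    using \<open>c < d\<close> by (simp add: field_simps)
  then have "(k / M)\<^sup>2 < (pi / (d - c))\<^sup>2"
    using \<open>0 < k\<close> \<open>0 < M\<close> by (intro power_strict_mono) auto
  moreover have "(k / M)\<^sup>2 = \<Gamma> * m / M"
    unfolding power_divide k2 using \<open>0 < M\<close> by (simp add: power2_eq_square)
  moreover have "\<Gamma> < M / m * Q" if "\<Gamma> * m / M < Q" for Q
    using that \<open>0 < M\<close> \<open>0 < m\<close> by (simp add: field_simps)
  ultimately show ?thesis
    by simp
qed

text \<open>The product \<open>w p\<close> vanishes at both ends, but for negative \<Gamma> its
  derivative is a sum of two nonnegative terms that vanish together only where
  \<open>w = p = 0\<close>.\<close>

lemma sturm_no_negative_eigenvalue: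
  fixes w p r :: "real \<Rightarrow> real"
  assumes "a < c" "\<Gamma> < 0"
    and r: "\<And>x. x \<in> {a..c} \<Longrightarrow> 0 < r x"
    and w: "\<And>x. x \<in> {a..c} \<Longrightarrow> (w has_real_derivative p x / r x) (at x within {a..c})"
    and p: "\<And>x. x \<in> {a..c} \<Longrightarrow> (p has_real_derivative - \<Gamma> * r x * w x) (at x within {a..c})"
    and ends: "p a = 0" "p c = 0"
    and nontriv: "\<And>x. x \<in> {a..c} \<Longrightarrow> w x = 0 \<Longrightarrow> p x \<noteq> 0"
  shows False
proof -
  define H' where "H' x = (p x)\<^sup>2 / r x - \<Gamma> * r x * (w x)\<^sup>2" for x
  have "((\<lambda>x. w x * p x) has_real_derivative H' x) (at x within {a..c})" if x: "x \<in> {a..c}" for x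
    by (rule derivative_eq_intros p[OF x] w[OF x] refl)+ (simp add: H'_def power2_eq_square)
  then obtain \<xi> where \<xi>: "\<xi> \<in> {a<..<c}" "w c * p c - w a * p a = (c - a) * H' \<xi>"
    using mvt_within[OF \<open>a < c\<close>] by blast
  then have "H' \<xi> = 0"
    using ends \<open>a < c\<close> by simp
  have x: "\<xi> \<in> {a..c}"
    using \<xi>(1) by simp
  have "0 \<le> (p \<xi>)\<^sup>2 / r \<xi>" "0 \<le> - \<Gamma> * r \<xi> * (w \<xi>)\<^sup>2"
    using r[OF x] \<open>\<Gamma> < 0\<close> by (auto simp: mult_nonpos_nonneg)
  then have "(p \<xi>)\<^sup>2 / r \<xi> = 0" "\<Gamma> * r \<xi> * (w \<xi>)\<^sup>2 = 0"
    using \<open>H' \<xi> = 0\<close> unfolding H'_def by simp_all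
  then show False
    using nontriv[OF x] r[OF x] \<open>\<Gamma> < 0\<close> by simp
qed

section \<open>The shooting solution and the ground state\<close>

text \<open>\<open>c\<close> is the least point of the compact set where \<open>f \<le> 0\<close>. A
  negative value at \<open>c\<close> would, by the intermediate value theorem, produce an earlier
  point of that set.\<close>

lemma nonpos_somewhere_obtains_first_zero:
  fixes f :: "real \<Rightarrow> real"
  assumes cont: "continuous_on {a..b} f" and "0 < f a" "x \<in> {a..b}" "f x \<le> 0"
  obtains c where "c \<in> {a<..b}" "f c = 0" "\<And>t. t \<in> {a..<c} \<Longrightarrow> 0 < f t"
proof -
  let ?S = "{a..b} \<inter> f -` {..0}"
  have "closed ?S"
    by (intro continuous_closed_preimage cont closed_atLeastAtMost closed_atMost)
  then have "compact ?S"
    using compact_Int_closed[OF compact_Icc, of ?S a b] by (simp add: Int_assoc[symmetric])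
  moreover have "?S \<noteq> {}"
    using assms by auto
  ultimately obtain c where c: "c \<in> ?S" "\<And>t. t \<in> ?S \<Longrightarrow> c \<le> t"
    using compact_attains_inf[of ?S] by metis
  have pos: "0 < f t" if "t \<in> {a..<c}" for t
  proof (rule ccontr)
    assume "\<not> 0 < f t"
    then have "t \<in> ?S"
      using that c(1) by auto
    then show False
      using c(2)[of t] that by simp
  qed
  have "a < c"
    using c(1) \<open>0 < f a\<close> by (cases "c = a") auto
  moreover have "f c = 0"
  proof (rule ccontr)
    assume "f c \<noteq> 0"
    moreover have "continuous_on {a..c} f"
      using c(1) by (auto intro: continuous_on_subset[OF cont])
    ultimately obtain t where "a \<le> t" "t \<le> c" "f t = f c / 2"
      using IVT2'[of f c "f c / 2" a] c(1) \<open>0 < f a\<close> \<open>a < c\<close> by auto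
    moreover have "f c < 0"
      using c(1) \<open>f c \<noteq> 0\<close> by simp
    ultimately show False
      using pos[of t] by (cases "t = c") auto
  qed
  ultimately show thesis
    using that[of c] c(1) pos by auto
qed

text \<open>The bounds on the potential hold at every point of the closed interval, not just almost
  everywhere. A representative with this property is chosen only in the final theorem.\<close>

locale schroedinger_interval =
  fixes v :: "real \<Rightarrow> real" and a b C :: real
  assumes a_less_b: "a < b"
    and v_measurable: "v \<in> borel_measurable (lebesgue_on {a..b})"
    and v_nonneg: "\<And>x. x \<in> {a..b} \<Longrightarrow> 0 \<le> v x"
    and v_le: "\<And>x. x \<in> {a..b} \<Longrightarrow> v x \<le> C"
begin

lemma C_nonneg: "0 \<le> C"
  using v_nonneg[of a] v_le[of a] a_less_b by auto

lemma potential_bound: "x \<in> {a..b} \<Longrightarrow> \<bar>v x - \<mu>\<bar> \<le> C + \<bar>\<mu>\<bar>"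
  using v_nonneg[of x] v_le[of x] by (simp add: abs_if split: if_splits)

lemma v_integrable: "v integrable_on {a..b}"
  using bounded_mult_continuous_integrable[of v a b C "\<lambda>_. 1::real"] v_measurable v_nonneg v_le
  by auto

section \<open>The shooting solution and its dependence on the spectral parameter\<close>

definition sol :: "real \<Rightarrow> (real \<Rightarrow> real) \<times> (real \<Rightarrow> real)" where
  "sol \<mu> = (SOME s. solves a b (\<lambda>x. v x - \<mu>) (fst s) (snd s) \<and> fst s a = 1 \<and> snd s a = 0)"

definition U :: "real \<Rightarrow> real \<Rightarrow> real" where "U \<mu> = fst (sol \<mu>)"

definition Y :: "real \<Rightarrow> real \<Rightarrow> real" where "Y \<mu> = snd (sol \<mu>)"

lemma sol_props:
  shows solves_U: "solves a b (\<lambda>x. v x - \<mu>) (U \<mu>) (Y \<mu>)"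
    and U_a [simp]: "U \<mu> a = 1" and Y_a [simp]: "Y \<mu> a = 0"
proof -
  have "\<exists>u y. solves a b (\<lambda>x. v x - \<mu>) u y \<and> u a = 1 \<and> y a = (0::real)"
    using a_less_b v_measurable potential_bound by (intro solves_exists[where K = "C + \<bar>\<mu>\<bar>"]) auto
  then have "\<exists>s. solves a b (\<lambda>x. v x - \<mu>) (fst s) (snd s) \<and> fst s a = 1 \<and> snd s a = (0::real)"
    by simp
  from someI_ex[OF this]
  show "solves a b (\<lambda>x. v x - \<mu>) (U \<mu>) (Y \<mu>)" "U \<mu> a = 1" "Y \<mu> a = 0"
    unfolding sol_def[symmetric] U_def Y_def by blast+
qed

lemma U_primitive: "primitive_on a b (U \<mu>) (Y \<mu>)"
  and Y_primitive: "primitive_on a b (Y \<mu>) (\<lambda>x. (v x - \<mu>) * U \<mu> x)"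
  using solves_U[of \<mu>] unfolding solves_def by auto

lemma continuous_on_U: "continuous_on {a..b} (U \<mu>)"
  and continuous_on_Y: "continuous_on {a..b} (Y \<mu>)"
  using U_primitive Y_primitive primitive_on_continuous by blast+

lemma U_has_derivative: "x \<in> {a..b} \<Longrightarrow> (U \<mu> has_real_derivative Y \<mu> x) (at x within {a..b})"
  using primitive_on_has_real_derivative[OF U_primitive continuous_on_Y] .

text \<open>Zeros are simple: vanishing Cauchy data at \<open>x\<close> would propagate back to
  \<open>a\<close>, where the solution equals 1.\<close>

lemma U_zero_imp_Y_nonzero: "x \<in> {a..b} \<Longrightarrow> U \<mu> x = 0 \<Longrightarrow> Y \<mu> x \<noteq> 0"
  using solves_zero_backward[OF solves_U, of x] potential_bound U_a by (metis zero_neq_one)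

lemma Y_integrand_bounded:
  obtains B where "\<And>x. x \<in> {a..b} \<Longrightarrow> \<bar>(v x - \<mu>) * U \<mu> x\<bar> \<le> B"
proof -
  obtain M where "0 < M" "\<And>x. x \<in> {a..b} \<Longrightarrow> norm (U \<mu> x) \<le> M"
    using continuous_on_Icc_bounded[OF continuous_on_U] by metis
  then have "\<bar>(v x - \<mu>) * U \<mu> x\<bar> \<le> (C + \<bar>\<mu>\<bar>) * M" if "x \<in> {a..b}" for x
    unfolding abs_mult using potential_bound[OF that] that by (intro mult_mono') auto
  then show thesis by (rule that)
qed

text \<open>\<open>solves_diff_bound\<close> with \<epsilon> replaced by
  \<open>\<bar>\<nu> - \<mu>\<bar>\<close>. Keeping \<nu> within distance 1 of \<mu> yields one
  Lipschitz constant \<open>A\<close> for all such \<nu>.\<close>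

lemma sol_eventually_close:
  assumes "0 < \<epsilon>"
  shows "\<forall>\<^sub>F \<nu> in nhds \<mu>. \<forall>x\<in>{a..b}. \<bar>U \<nu> x - U \<mu> x\<bar> < \<epsilon> \<and> \<bar>Y \<nu> x - Y \<mu> x\<bar> < \<epsilon>"
proof -
  obtain M where M: "0 < M" "\<And>x. x \<in> {a..b} \<Longrightarrow> norm (U \<mu> x) \<le> M"
    using continuous_on_Icc_bounded[OF continuous_on_U] by metis
  define A where "A = M * (b - a) * exp ((C + \<bar>\<mu>\<bar> + 1) * (b - a))"
  have "0 < A"
    using M a_less_b by (simp add: A_def)
  have "\<bar>U \<nu> x - U \<mu> x\<bar> < \<epsilon> \<and> \<bar>Y \<nu> x - Y \<mu> x\<bar> < \<epsilon>"
    if \<nu>: "dist \<nu> \<mu> < min 1 (\<epsilon> / A)" and x: "x \<in> {a..b}" for \<nu> x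
  proof -
    have "\<bar>v t - \<nu>\<bar> \<le> C + \<bar>\<mu>\<bar> + 1" if "t \<in> {a..b}" for t
      using potential_bound[OF that, of \<nu>] \<nu> by (auto simp: dist_real_def)
    then have "norm (U \<nu> x - U \<mu> x) + norm (Y \<nu> x - Y \<mu> x)
        \<le> \<bar>\<nu> - \<mu>\<bar> * M * (b - a) * exp ((C + \<bar>\<mu>\<bar> + 1) * (b - a))"
      using M(2) x C_nonneg by (intro solves_diff_bound[OF solves_U solves_U]) auto
    also have "\<dots> = \<bar>\<nu> - \<mu>\<bar> * A"
      by (simp add: A_def)
    also have "\<dots> < \<epsilon>"
      using \<nu> \<open>0 < A\<close> by (simp add: dist_real_def pos_less_divide_eq)
    finally show ?thesis by auto
  qed
  then show ?thesis
    unfolding eventually_nhds_metric using \<open>0 < A\<close> \<open>0 < \<epsilon>\<close>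
    by (intro exI[of _ "min 1 (\<epsilon> / A)"]) auto
qed

text \<open>The two terms containing \<open>v\<close> cancel. What remains of the integrand is
  continuous, so the Wronskian is differentiable everywhere although \<open>Y\<close> need not
  be.\<close>

lemma wronskian_has_derivative:
  assumes "x \<in> {a..b}"
  shows "((\<lambda>x. U \<mu> x * Y \<nu> x - U \<nu> x * Y \<mu> x) has_real_derivative (\<mu> - \<nu>) * U \<mu> x * U \<nu> x)
    (at x within {a..b})"
proof -
  obtain B1 B2 where "\<And>x. x \<in> {a..b} \<Longrightarrow> \<bar>(v x - \<mu>) * U \<mu> x\<bar> \<le> B1"
    "\<And>x. x \<in> {a..b} \<Longrightarrow> \<bar>(v x - \<nu>) * U \<nu> x\<bar> \<le> B2"
    using Y_integrand_bounded by metis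
  then have "primitive_on a b (\<lambda>x. U \<mu> x * Y \<nu> x) (\<lambda>x. U \<mu> x * ((v x - \<nu>) * U \<nu> x) + Y \<mu> x * Y \<nu> x)"
    "primitive_on a b (\<lambda>x. U \<nu> x * Y \<mu> x) (\<lambda>x. U \<nu> x * ((v x - \<mu>) * U \<mu> x) + Y \<nu> x * Y \<mu> x)"
    using primitive_on_mult[OF U_primitive continuous_on_Y Y_primitive] by blast+
  from primitive_on_diff_primitive[OF this]
  have "primitive_on a b (\<lambda>x. U \<mu> x * Y \<nu> x - U \<nu> x * Y \<mu> x) (\<lambda>x. (\<mu> - \<nu>) * U \<mu> x * U \<nu> x)"
    by (rule primitive_on_cong) (use a_less_b in \<open>auto simp: algebra_simps\<close>)
  then show ?thesis
    using assms continuous_on_U by (intro primitive_on_has_real_derivative) (auto intro!: continuous_intros)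
qed

text \<open>The quotient is treated as \<open>1 / U\<close> times \<open>Y\<close>: the first factor
  is continuously differentiable, so \<open>primitive_on_mult\<close> accepts the bounded integrand
  of the second.\<close>

lemma riccati:
  assumes pos: "\<And>x. x \<in> {a..b} \<Longrightarrow> 0 < U \<mu> x"
  shows "primitive_on a b (\<lambda>x. Y \<mu> x / U \<mu> x) (\<lambda>x. v x - \<mu> - (Y \<mu> x / U \<mu> x)\<^sup>2)"
proof -
  have nz: "U \<mu> x \<noteq> 0" if "x \<in> {a..b}" for x
    using pos[OF that] by simp
  note [continuous_intros] = continuous_on_U continuous_on_Y
  have "((\<lambda>x. 1 / U \<mu> x) has_real_derivative - Y \<mu> x / (U \<mu> x)\<^sup>2) (at x within {a..b})"
    if "x \<in> {a..b}" for x
    using nz[OF that]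
    by (auto intro!: derivative_eq_intros U_has_derivative[OF that] simp: power2_eq_square)
  moreover have cont: "continuous_on {a..b} (\<lambda>x. - Y \<mu> x / (U \<mu> x)\<^sup>2)"
    using nz by (auto intro!: continuous_intros)
  ultimately have "primitive_on a b (\<lambda>x. 1 / U \<mu> x) (\<lambda>x. - Y \<mu> x / (U \<mu> x)\<^sup>2)"
    by (rule has_real_derivative_primitive_on)
  moreover obtain B where "\<And>x. x \<in> {a..b} \<Longrightarrow> \<bar>(v x - \<mu>) * U \<mu> x\<bar> \<le> B"
    using Y_integrand_bounded by metis
  ultimately have "primitive_on a b (\<lambda>x. 1 / U \<mu> x * Y \<mu> x)
    (\<lambda>x. 1 / U \<mu> x * ((v x - \<mu>) * U \<mu> x) + - Y \<mu> x / (U \<mu> x)\<^sup>2 * Y \<mu> x)"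
    by (intro primitive_on_mult cont Y_primitive)
  then show ?thesis
    by (rule primitive_on_cong) (use nz a_less_b in \<open>auto simp: power2_eq_square field_simps\<close>)
qed

definition mass :: real where "mass = integral {a..b} v"

text \<open>The square in the Riccati equation enters with a negative sign and is dropped; since
  \<open>v\<close> is nonnegative, its integral over the subinterval is at most the total
  \<open>mass\<close>.\<close>

lemma riccati_increment_le:
  assumes pos: "\<And>x. x \<in> {a..b} \<Longrightarrow> 0 < U \<mu> x" and "a \<le> x" "x \<le> z" "z \<le> b"
  shows "Y \<mu> z / U \<mu> z - Y \<mu> x / U \<mu> x \<le> mass - \<mu> * (z - x)"
proof -
  have sub: "{x..z} \<subseteq> {a..b}"
    using assms by auto
  have v_int: "v integrable_on {x..z}"
    using v_integrable sub integrable_subinterval_real by blast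
  have "Y \<mu> z / U \<mu> z - Y \<mu> x / U \<mu> x = integral {x..z} (\<lambda>x. v x - \<mu> - (Y \<mu> x / U \<mu> x)\<^sup>2)"
    by (rule primitive_on_diff[OF riccati[OF pos] assms(2-4)])
  also have "\<dots> \<le> integral {x..z} (\<lambda>x. v x - \<mu>)"
    by (rule integral_le[OF primitive_on_integrable[OF riccati[OF pos] assms(2,4)]
          integrable_diff[OF v_int integrable_const_ivl]]) auto
  also have "\<dots> = integral {x..z} v - integral {x..z} (\<lambda>_. \<mu>)"
    by (intro Henstock_Kurzweil_Integration.integral_diff v_int integrable_const_ivl)
  also have "\<dots> = integral {x..z} v - \<mu> * (z - x)"
    using assms by (simp add: mult.commute)
  also have "integral {x..z} v \<le> mass"
    unfolding mass_def using v_nonneg by (intro integral_subset_le sub v_int v_integrable) auto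
  finally show ?thesis by simp
qed

section \<open>The ground state as a supremum of spectral parameters\<close>

definition ground_set :: "real set" where
  "ground_set = {\<mu>. 0 \<le> \<mu> \<and> (\<forall>x\<in>{a..b}. 0 < U \<mu> x) \<and> 0 \<le> Y \<mu> b}"

definition E\<^sub>0 :: real where "E\<^sub>0 = Sup ground_set"

text \<open>For \<mu> = 0 the equation is \<open>u'' = v u\<close>. As long as \<open>u\<close> is
  positive its slope cannot become negative, so \<open>u\<close> never falls below its initial value
  and has no first zero.\<close>

lemma zero_in_ground_set: "0 \<in> ground_set"
proof -
  have Y_nonneg: "0 \<le> Y 0 x" if "x \<in> {a..b}" "\<And>t. t \<in> {a..<x} \<Longrightarrow> 0 < U 0 t" for x
  proof -
    have "Y 0 x = integral {a..x} (\<lambda>x. (v x - 0) * U 0 x)"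
      using primitive_on_eq[OF Y_primitive that(1), of 0] by simp
    moreover have "0 \<le> U 0 t" if "t \<in> {a..x}" for t
    proof (cases "a = x")
      case False
      have "continuous_on {a..x} (U 0)" 
        using \<open>x \<in> {a..b}\<close> by (auto intro: continuous_on_subset[OF continuous_on_U])
      then show ?thesis
        using that \<open>\<And>t. t \<in> {a..<x} \<Longrightarrow> 0 < U 0 t\<close> False
          continuous_ge_on_closure[of "{a..<x}" "U 0" t 0] by (auto intro: less_imp_le)
    next
      case True
      then have "t = a"
        using that by simp
      then show ?thesis
        by (simp only: U_a zero_le_one)
    qed
    ultimately show ?thesis
      using that(1) v_nonneg primitive_on_integrable[OF Y_primitive, of a x 0]
      by (auto intro!: integral_nonneg)
  qed
  have pos: "0 < U 0 x" if x: "x \<in> {a..b}" for x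
  proof (rule ccontr)
    assume "\<not> 0 < U 0 x"
    then obtain c where c: "c \<in> {a<..b}" "U 0 c = 0" "\<And>t. t \<in> {a..<c} \<Longrightarrow> 0 < U 0 t"
      using nonpos_somewhere_obtains_first_zero[OF continuous_on_U[of 0], of x] x by auto
    have "0 \<le> integral {a..c} (Y 0)"
      using c(1,3) by (intro integral_nonneg primitive_on_integrable[OF U_primitive] Y_nonneg) auto
    then show False
      using primitive_on_eq[OF U_primitive, of c 0] c(1,2) by simp
  qed
  then show ?thesis
    using Y_nonneg[of b] a_less_b by (simp add: ground_set_def)
qed

text \<open>Over the whole interval the logarithmic derivative starts at 0 and ends at a nonnegative
  value, so the bound in \<open>riccati_increment_le\<close> cannot be negative.\<close>

lemma ground_set_bounded: "\<mu> \<in> ground_set \<Longrightarrow> \<mu> \<le> mass / (b - a)"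
proof -
  assume "\<mu> \<in> ground_set"
  then have \<mu>: "\<And>x. x \<in> {a..b} \<Longrightarrow> 0 < U \<mu> x" "0 \<le> Y \<mu> b"
    by (auto simp: ground_set_def)
  have "0 \<le> mass - \<mu> * (b - a)"
    using riccati_increment_le[OF \<mu>(1), of a b] \<mu> a_less_b by (smt (verit) Y_a atLeastAtMost_iff
        divide_nonneg_pos div_0)
  then show ?thesis
    using a_less_b by (simp add: pos_le_divide_eq)
qed

lemma ground_set_bdd_above: "bdd_above ground_set"
  using ground_set_bounded by (intro bdd_aboveI)

lemma E\<^sub>0_nonneg: "0 \<le> E\<^sub>0"
  unfolding E\<^sub>0_def by (intro cSup_upper zero_in_ground_set ground_set_bdd_above)

text \<open>The weak inequalities survive the limit. Positivity then follows from simplicity of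
  zeros: a nonnegative solution with a simple zero would turn negative on one side, and at
  \<open>b\<close> the remaining possibility of a negative slope is excluded by
  \<open>Y_nonneg\<close>.\<close>

lemma E\<^sub>0_in_ground_set: "E\<^sub>0 \<in> ground_set"
proof -
  \<comment> \<open>A property shared by all parameters close to the supremum holds for some member
    of the set.\<close>
  have approx: "\<exists>\<nu>\<in>ground_set. P \<nu>" if ev: "\<forall>\<^sub>F \<nu> in nhds E\<^sub>0. P \<nu>" for P
  proof -
    obtain d where d: "0 < d" "\<And>\<nu>. dist \<nu> E\<^sub>0 < d \<Longrightarrow> P \<nu>"
      using ev unfolding eventually_nhds_metric by blast
    obtain \<nu> where "\<nu> \<in> ground_set" "E\<^sub>0 - d < \<nu>"
      using less_cSupD[of ground_set "E\<^sub>0 - d"] zero_in_ground_set d(1) unfolding E\<^sub>0_def by auto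
    moreover have "\<nu> \<le> E\<^sub>0"
      unfolding E\<^sub>0_def by (intro cSup_upper ground_set_bdd_above) fact
    ultimately show ?thesis
      using d(2)[of \<nu>] by (auto simp: dist_real_def)
  qed
  have U_nonneg: "0 \<le> U E\<^sub>0 x" if x: "x \<in> {a..b}" for x
  proof (rule ccontr)
    assume "\<not> 0 \<le> U E\<^sub>0 x"
    then have "0 < - U E\<^sub>0 x"
      by simp
    from approx[OF sol_eventually_close[OF this]] obtain \<nu> where "\<nu> \<in> ground_set"
      "\<bar>U \<nu> x - U E\<^sub>0 x\<bar> < - U E\<^sub>0 x"
      using x by blast
    moreover from this have "0 < U \<nu> x"
      using x by (simp add: ground_set_def)
    ultimately show False
      by linarith
  qed
  have Y_nonneg: "0 \<le> Y E\<^sub>0 b"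
  proof (rule ccontr)
    assume "\<not> 0 \<le> Y E\<^sub>0 b"
    then have "0 < - Y E\<^sub>0 b"
      by simp
    from approx[OF sol_eventually_close[OF this]] obtain \<nu> where "\<nu> \<in> ground_set"
      "\<bar>Y \<nu> b - Y E\<^sub>0 b\<bar> < - Y E\<^sub>0 b"
      using a_less_b by auto
    then show False
      unfolding ground_set_def by auto
  qed
  have "U E\<^sub>0 x \<noteq> 0" if x: "x \<in> {a..b}" for x
  proof
    assume U0: "U E\<^sub>0 x = 0"
    have "a < x"
      using x U0 U_a[of "E\<^sub>0"] by (cases "x = a") auto
    consider "Y E\<^sub>0 x > 0" | "Y E\<^sub>0 x < 0"
      using U_zero_imp_Y_nonzero[OF x U0] by linarith
    then show False
    proof cases
      case 1
      then obtain d where d: "0 < d" "\<And>h. 0 < h \<Longrightarrow> x - h \<in> {a..b} \<Longrightarrow> h < d \<Longrightarrow> U E\<^sub>0 (x - h) < U E\<^sub>0 x"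
        using has_real_derivative_pos_inc_left[OF U_has_derivative[OF x]] by blast
      define h where "h = min (d / 2) (x - a)"
      have "0 < h" "x - h \<in> {a..b}" "h < d"
        using d(1) \<open>a < x\<close> x by (auto simp: h_def)
      then show False
        using d(2)[of h] U_nonneg[of "x - h"] U0 by auto
    next
      case 2
      then have "x < b"
        using x Y_nonneg by (cases "x = b") auto
      obtain d where d: "0 < d" "\<And>h. 0 < h \<Longrightarrow> x + h \<in> {a..b} \<Longrightarrow> h < d \<Longrightarrow> U E\<^sub>0 (x + h) < U E\<^sub>0 x"
        using has_real_derivative_neg_dec_right[OF U_has_derivative[OF x] 2] by blast
      define h where "h = min (d / 2) (b - x)"
      have "0 < h" "x + h \<in> {a..b}" "h < d"
        using d(1) \<open>x < b\<close> x by (auto simp: h_def)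
      then show False
        using d(2)[of h] U_nonneg[of "x + h"] U0 by auto
    qed
  qed
  then show ?thesis
    using U_nonneg Y_nonneg E\<^sub>0_nonneg unfolding ground_set_def
    by (auto simp: order_less_le)
qed

lemma ground_state_pos: "x \<in> {a..b} \<Longrightarrow> 0 < U E\<^sub>0 x"
  using E\<^sub>0_in_ground_set by (simp add: ground_set_def)

text \<open>If the slope at \<open>b\<close> were positive, all conditions at
  \<open>E\<^sub>0\<close> would hold with the margin \<epsilon>, the lesser of the minimum of the
  solution and that slope. A slightly larger parameter would then still belong to
  \<open>ground_set\<close>.\<close>

lemma ground_state_neumann: "Y E\<^sub>0 b = 0"
proof (rule ccontr)
  assume "Y E\<^sub>0 b \<noteq> 0"
  then have Y_pos: "0 < Y E\<^sub>0 b"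
    using E\<^sub>0_in_ground_set by (simp add: ground_set_def)
  obtain m where m: "m \<in> {a..b}" "\<And>x. x \<in> {a..b} \<Longrightarrow> U E\<^sub>0 m \<le> U E\<^sub>0 x"
    using continuous_attains_inf[OF compact_Icc _ continuous_on_U[of E\<^sub>0]] a_less_b by auto
  define \<epsilon> where "\<epsilon> = min (U E\<^sub>0 m) (Y E\<^sub>0 b)"
  have "0 < \<epsilon>"
    using ground_state_pos[OF m(1)] Y_pos by (simp add: \<epsilon>_def)
  then obtain d where d: "0 < d" "\<And>\<nu> x. dist \<nu> E\<^sub>0 < d \<Longrightarrow> x \<in> {a..b} \<Longrightarrow>
      \<bar>U \<nu> x - U E\<^sub>0 x\<bar> < \<epsilon> \<and> \<bar>Y \<nu> x - Y E\<^sub>0 x\<bar> < \<epsilon>"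
    using sol_eventually_close[of \<epsilon> E\<^sub>0] unfolding eventually_nhds_metric by blast
  have close: "\<bar>U (E\<^sub>0 + d / 2) x - U E\<^sub>0 x\<bar> < \<epsilon>" "\<bar>Y (E\<^sub>0 + d / 2) x - Y E\<^sub>0 x\<bar> < \<epsilon>"
    if "x \<in> {a..b}" for x
    using d that by (auto simp: dist_real_def)
  have "0 < U (E\<^sub>0 + d / 2) x" if "x \<in> {a..b}" for x
    using close(1)[OF that] m(2)[OF that] by (auto simp: \<epsilon>_def)
  moreover have "0 \<le> Y (E\<^sub>0 + d / 2) b"
    using close(2)[of b] a_less_b by (auto simp: \<epsilon>_def)
  ultimately have "E\<^sub>0 + d / 2 \<in> ground_set"
    using E\<^sub>0_nonneg d(1) by (simp add: ground_set_def)
  then have "E\<^sub>0 + d / 2 \<le> E\<^sub>0"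
    unfolding E\<^sub>0_def by (rule cSup_upper[OF _ ground_set_bdd_above])
  then show False
    using d(1) by simp
qed

text \<open>The logarithmic derivative is 0 at both ends. Its increment from \<open>a\<close> to
  \<open>x\<close> bounds it above, its increment from \<open>x\<close> to \<open>b\<close> bounds
  it below; \<open>E\<^sub>0_nonneg\<close> removes the terms with \<open>E\<^sub>0\<close>.\<close>

lemma log_derivative_ground_state_bound:
  assumes x: "x \<in> {a..b}"
  shows "\<bar>Y E\<^sub>0 x / U E\<^sub>0 x\<bar> \<le> mass"
proof -
  have "0 \<le> E\<^sub>0 * (x - a)" "0 \<le> E\<^sub>0 * (b - x)"
    using x E\<^sub>0_nonneg by auto
  then show ?thesis
    using riccati_increment_le[OF ground_state_pos, of a x] riccati_increment_le[OF ground_state_pos, of x b]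
      x ground_state_neumann by simp
qed

lemma mass_nonneg: "0 \<le> mass"
  unfolding mass_def using v_nonneg v_integrable by (intro integral_nonneg) auto

text \<open>The logarithm of the ground state is Lipschitz with constant \<open>mass\<close>. The
  gap estimate sees the potential only through this control of the oscillation.\<close>

lemma harnack:
  assumes x: "x \<in> {a..b}" "z \<in> {a..b}"
  shows "U E\<^sub>0 x \<le> exp (mass * (b - a)) * U E\<^sub>0 z"
proof -
  have "norm (ln (U E\<^sub>0 x) - ln (U E\<^sub>0 z)) \<le> mass * norm (x - z)"
  proof (rule field_differentiable_bound[of "{a..b}"])
    show "((\<lambda>x. ln (U E\<^sub>0 x)) has_field_derivative Y E\<^sub>0 t / U E\<^sub>0 t) (at t within {a..b})"
      if "t \<in> {a..b}" for t
      using ground_state_pos[OF that]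
      by (auto intro!: derivative_eq_intros U_has_derivative[OF that])
  qed (use x log_derivative_ground_state_bound in auto)
  also have "\<dots> \<le> mass * (b - a)"
    using x mass_nonneg by (intro mult_left_mono) auto
  finally have "ln (U E\<^sub>0 x) \<le> mass * (b - a) + ln (U E\<^sub>0 z)"
    by auto
  also have "\<dots> = ln (exp (mass * (b - a)) * U E\<^sub>0 z)"
    using ground_state_pos[OF x(2)] by (subst ln_mult) auto
  finally show ?thesis
    using ground_state_pos x by (subst (asm) ln_le_cancel_iff) auto
qed

end

section \<open>The first excited state\<close>

context schroedinger_interval
begin

section \<open>Reduction to a Sturm system without potential\<close>

definition W :: "real \<Rightarrow> real \<Rightarrow> real" where "W \<mu> x = U \<mu> x / U E\<^sub>0 x"

definition P :: "real \<Rightarrow> real \<Rightarrow> real" where "P \<mu> x = U E\<^sub>0 x * Y \<mu> x - U \<mu> x * Y E\<^sub>0 x"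

lemma P_has_derivative:
  assumes "x \<in> {a..b}"
  shows "(P \<mu> has_real_derivative - (\<mu> - E\<^sub>0) * (U E\<^sub>0 x)\<^sup>2 * W \<mu> x) (at x within {a..b})"
proof -
  have "(P \<mu> has_real_derivative (E\<^sub>0 - \<mu>) * U E\<^sub>0 x * U \<mu> x) (at x within {a..b})"
    using wronskian_has_derivative[OF assms, of E\<^sub>0 \<mu>] unfolding P_def .
  then show ?thesis
    using ground_state_pos[OF assms] by (simp add: W_def power2_eq_square mult.assoc)
qed

lemma W_has_derivative:
  assumes "x \<in> {a..b}"
  shows "(W \<mu> has_real_derivative P \<mu> x / (U E\<^sub>0 x)\<^sup>2) (at x within {a..b})"
  unfolding W_def[abs_def] using ground_state_pos[OF assms]
  by (auto intro!: derivative_eq_intros U_has_derivative[OF assms] simp: P_def power2_eq_square mult.commute)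

lemma continuous_on_P: "continuous_on {a..b} (P \<mu>)"
  using DERIV_continuous_on[OF P_has_derivative] .

lemma P_a: "P \<mu> a = 0" and P_b: "P \<mu> b = U E\<^sub>0 b * Y \<mu> b"
  by (simp_all add: P_def ground_state_neumann)

lemma W_zero_imp_P_nonzero: "x \<in> {a..b} \<Longrightarrow> W \<mu> x = 0 \<Longrightarrow> P \<mu> x \<noteq> 0"
  using ground_state_pos[of x] U_zero_imp_Y_nonzero[of x \<mu>] by (simp add: W_def P_def)

text \<open>\<open>harnack\<close> is applied in both directions against the point \<open>a\<close>,
  where the ground state is normalised to 1; squaring doubles the exponent.\<close>

lemma ground_state_sq_bounds:
  assumes "x \<in> {a..b}"
  shows "exp (- 2 * mass * (b - a)) \<le> (U E\<^sub>0 x)\<^sup>2" "(U E\<^sub>0 x)\<^sup>2 \<le> exp (2 * mass * (b - a))"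
proof -
  let ?e = "exp (mass * (b - a))"
  have a: "a \<in> {a..b}" using a_less_b by simp
  have "1 \<le> ?e * U E\<^sub>0 x" "U E\<^sub>0 x \<le> ?e"
    using harnack[OF a assms] harnack[OF assms a] by simp_all
  moreover have "inverse ?e \<le> U E\<^sub>0 x" if "1 \<le> ?e * U E\<^sub>0 x"
    using that by (simp add: divide_le_eq inverse_eq_divide mult.commute)
  ultimately have "(inverse ?e)\<^sup>2 \<le> (U E\<^sub>0 x)\<^sup>2" "(U E\<^sub>0 x)\<^sup>2 \<le> ?e\<^sup>2"
    using ground_state_pos[OF assms] by (auto intro!: power_mono)
  moreover have "(inverse ?e)\<^sup>2 = exp (- 2 * mass * (b - a))" "?e\<^sup>2 = exp (2 * mass * (b - a))"
    by (simp_all add: exp_minus[symmetric] exp_double[symmetric] mult.assoc)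
  ultimately show "exp (- 2 * mass * (b - a)) \<le> (U E\<^sub>0 x)\<^sup>2" "(U E\<^sub>0 x)\<^sup>2 \<le> exp (2 * mass * (b - a))"
    by simp_all
qed

text \<open>The factor 4 comes from the quotient of the two bounds on the squared ground state.
  Allowing zeros \<open>c\<close> before \<open>b\<close> matters: the bound blows up as
  \<open>c\<close> tends to \<open>a\<close>, which later keeps zeros away from
  \<open>a\<close>.\<close>

lemma P_zero_gap:
  assumes "E\<^sub>0 < \<mu>" "c \<in> {a<..b}" "P \<mu> c = 0"
  shows "exp (- 4 * mass * (b - a)) * (pi / (c - a))\<^sup>2 \<le> \<mu> - E\<^sub>0"
proof -
  have sub: "{a..c} \<subseteq> {a..b}"
    using assms(2) by auto
  have "exp (- 2 * mass * (b - a)) / exp (2 * mass * (b - a)) * (pi / (c - a))\<^sup>2 \<le> \<mu> - E\<^sub>0"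
  proof (rule sturm_first_zero_lower_bound[where r = "\<lambda>x. (U E\<^sub>0 x)\<^sup>2" and w = "W \<mu>" and p = "P \<mu>"])
    fix x assume "x \<in> {a..c}"
    then have x: "x \<in> {a..b}" using sub by auto
    show "exp (- 2 * mass * (b - a)) \<le> (U E\<^sub>0 x)\<^sup>2" "(U E\<^sub>0 x)\<^sup>2 \<le> exp (2 * mass * (b - a))"
      by (fact ground_state_sq_bounds[OF x])+
    show "(W \<mu> has_real_derivative P \<mu> x / (U E\<^sub>0 x)\<^sup>2) (at x within {a..c})"
      by (rule DERIV_subset[OF W_has_derivative[OF x] sub])
    show "(P \<mu> has_real_derivative - (\<mu> - E\<^sub>0) * (U E\<^sub>0 x)\<^sup>2 * W \<mu> x) (at x within {a..c})"
      by (rule DERIV_subset[OF P_has_derivative[OF x] sub])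
    show "W \<mu> x = 0 \<Longrightarrow> P \<mu> x \<noteq> 0"
      by (rule W_zero_imp_P_nonzero[OF x])
  qed (use assms P_a in auto)
  also have "exp (- 2 * mass * (b - a)) / exp (2 * mass * (b - a)) = exp (- 4 * mass * (b - a))"
    by (simp add: exp_diff[symmetric] algebra_simps)
  finally show ?thesis .
qed

lemma no_eigenvalue_below_E\<^sub>0:
  assumes "\<mu> < E\<^sub>0"
  shows "Y \<mu> b \<noteq> 0"
proof
  assume "Y \<mu> b = 0"
  show False
  proof (rule sturm_no_negative_eigenvalue[OF a_less_b, of "\<mu> - E\<^sub>0" "\<lambda>x. (U E\<^sub>0 x)\<^sup>2" "W \<mu>" "P \<mu>"])
    show "0 < (U E\<^sub>0 x)\<^sup>2" if "x \<in> {a..b}" for x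
      using ground_state_pos[OF that] by simp
  qed (use assms \<open>Y \<mu> b = 0\<close> W_has_derivative P_has_derivative P_a P_b W_zero_imp_P_nonzero in auto)
qed

text \<open>\<open>P\<close> is linear in the pair of \<open>U\<close> and \<open>Y\<close>, with
  coefficients bounded on the interval, so it inherits their uniform closeness.\<close>

lemma P_eventually_close:
  assumes "0 < \<epsilon>"
  shows "\<forall>\<^sub>F \<nu> in nhds \<mu>. \<forall>x\<in>{a..b}. \<bar>P \<nu> x - P \<mu> x\<bar> < \<epsilon>"
proof -
  obtain M1 where M1: "0 < M1" "\<And>x. x \<in> {a..b} \<Longrightarrow> norm (U E\<^sub>0 x) \<le> M1"
    using continuous_on_Icc_bounded[OF continuous_on_U] by metis
  obtain M2 where M2: "0 < M2" "\<And>x. x \<in> {a..b} \<Longrightarrow> norm (Y E\<^sub>0 x) \<le> M2"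
    using continuous_on_Icc_bounded[OF continuous_on_Y] by metis
  define \<delta> where "\<delta> = \<epsilon> / (M1 + M2)"
  have "0 < \<delta>"
    using assms M1(1) M2(1) by (simp add: \<delta>_def)
  show ?thesis
  proof (rule eventually_mono[OF sol_eventually_close[OF \<open>0 < \<delta>\<close>]], intro ballI)
    fix \<nu> x
    assume close: "\<forall>x\<in>{a..b}. \<bar>U \<nu> x - U \<mu> x\<bar> < \<delta> \<and> \<bar>Y \<nu> x - Y \<mu> x\<bar> < \<delta>" and x: "x \<in> {a..b}"
    from close x have close': "\<bar>U \<nu> x - U \<mu> x\<bar> < \<delta>" "\<bar>Y \<nu> x - Y \<mu> x\<bar> < \<delta>"
      by blast+
    have bounds: "\<bar>U E\<^sub>0 x\<bar> \<le> M1" "\<bar>Y E\<^sub>0 x\<bar> \<le> M2"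
      using M1(2)[OF x] M2(2)[OF x] by simp_all
    have eq: "P \<nu> x - P \<mu> x = U E\<^sub>0 x * (Y \<nu> x - Y \<mu> x) - (U \<nu> x - U \<mu> x) * Y E\<^sub>0 x"
      by (simp add: P_def algebra_simps)
    have "\<bar>P \<nu> x - P \<mu> x\<bar> \<le> \<bar>U E\<^sub>0 x\<bar> * \<bar>Y \<nu> x - Y \<mu> x\<bar> + \<bar>U \<nu> x - U \<mu> x\<bar> * \<bar>Y E\<^sub>0 x\<bar>"
      unfolding abs_mult[symmetric] eq by (rule abs_triangle_ineq4)
    also have "\<dots> \<le> M1 * \<bar>Y \<nu> x - Y \<mu> x\<bar> + \<delta> * M2"
      by (rule add_mono[OF mult_right_mono[OF bounds(1) abs_ge_zero]
            mult_mono[OF less_imp_le[OF close'(1)] bounds(2) less_imp_le[OF \<open>0 < \<delta>\<close>] abs_ge_zero]])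
    also have "\<dots> < M1 * \<delta> + \<delta> * M2"
      using close'(2) M1(1) by simp
    also have "\<dots> = (M1 + M2) * \<delta>"
      by (simp add: algebra_simps)
    also have "\<dots> = \<epsilon>"
      using M1(1) M2(1) by (simp add: \<delta>_def)
    finally show "\<bar>P \<nu> x - P \<mu> x\<bar> < \<epsilon>" .
  qed
qed

definition excited_set :: "real set" where
  "excited_set = {\<mu>. E\<^sub>0 < \<mu> \<and> (\<exists>x\<in>{a<..b}. P \<mu> x = 0)}"

definition E\<^sub>1 :: real where "E\<^sub>1 = Inf excited_set"

text \<open>\<Gamma> is exactly the bound of \<open>sturm_no_zero_upper_bound\<close> on the right
  half, so absence of a zero there would give \<Gamma> < \<Gamma>. The interval starts at the
  midpoint because the zero of \<open>P\<close> at \<open>a\<close> must be avoided.\<close>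

lemma excited_set_nonempty: "excited_set \<noteq> {}"
proof -
  define c where "c = (a + b) / 2"
  let ?m = "exp (- 2 * mass * (b - a))" and ?M = "exp (2 * mass * (b - a))"
  define \<Gamma> where "\<Gamma> = ?M / ?m * (pi / (b - c))\<^sup>2"
  have c: "a < c" "c < b"
    using a_less_b by (simp_all add: c_def)
  have "0 < \<Gamma>"
    using c pi_gt_zero unfolding \<Gamma>_def by (intro mult_pos_pos divide_pos_pos zero_less_power) auto
  have sub: "{c..b} \<subseteq> {a..b}"
    using c by auto
  have "\<exists>x\<in>{c..b}. P (E\<^sub>0 + \<Gamma>) x = 0"
  proof (rule ccontr)
    assume nz: "\<not> (\<exists>x\<in>{c..b}. P (E\<^sub>0 + \<Gamma>) x = 0)"
    have "\<Gamma> < ?M / ?m * (pi / (b - c))\<^sup>2"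
    proof (rule sturm_no_zero_upper_bound[OF c(2) _ \<open>0 < \<Gamma>\<close>, where r = "\<lambda>x. (U E\<^sub>0 x)\<^sup>2"
          and w = "W (E\<^sub>0 + \<Gamma>)" and p = "P (E\<^sub>0 + \<Gamma>)"])
      fix x assume "x \<in> {c..b}"
      then have x: "x \<in> {a..b}" using sub by auto
      show "?m \<le> (U E\<^sub>0 x)\<^sup>2" "(U E\<^sub>0 x)\<^sup>2 \<le> ?M"
        by (fact ground_state_sq_bounds[OF x])+
      show "(W (E\<^sub>0 + \<Gamma>) has_real_derivative P (E\<^sub>0 + \<Gamma>) x / (U E\<^sub>0 x)\<^sup>2) (at x within {c..b})"
        by (rule DERIV_subset[OF W_has_derivative[OF x] sub])
      show "(P (E\<^sub>0 + \<Gamma>) has_real_derivative - \<Gamma> * (U E\<^sub>0 x)\<^sup>2 * W (E\<^sub>0 + \<Gamma>) x) (at x within {c..b})"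
        using DERIV_subset[OF P_has_derivative[OF x, of "E\<^sub>0 + \<Gamma>"] sub] by simp
      show "P (E\<^sub>0 + \<Gamma>) x \<noteq> 0"
        using nz \<open>x \<in> {c..b}\<close> by blast
    qed simp
    then show False
      by (simp add: \<Gamma>_def)
  qed
  then have "E\<^sub>0 + \<Gamma> \<in> excited_set"
    using c \<open>0 < \<Gamma>\<close> by (auto simp: excited_set_def)
  then show ?thesis by blast
qed

lemma excited_set_gap:
  assumes "\<mu> \<in> excited_set"
  shows "E\<^sub>0 + exp (- 4 * mass * (b - a)) * (pi / (b - a))\<^sup>2 \<le> \<mu>"
proof -
  obtain c where c: "E\<^sub>0 < \<mu>" "c \<in> {a<..b}" "P \<mu> c = 0"
    using assms by (auto simp: excited_set_def)
  have "pi / (b - a) \<le> pi / (c - a)"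
    using c(2) by (intro divide_left_mono) auto
  then have "exp (- 4 * mass * (b - a)) * (pi / (b - a))\<^sup>2 \<le> exp (- 4 * mass * (b - a)) * (pi / (c - a))\<^sup>2"
    using a_less_b by (intro mult_left_mono power_mono) auto
  then show ?thesis
    using P_zero_gap[OF c] by linarith
qed

lemma E\<^sub>1_gap: "E\<^sub>0 + exp (- 4 * mass * (b - a)) * (pi / (b - a))\<^sup>2 \<le> E\<^sub>1"
  unfolding E\<^sub>1_def by (intro cInf_greatest excited_set_nonempty excited_set_gap)

lemma E\<^sub>0_less_E\<^sub>1: "E\<^sub>0 < E\<^sub>1"
proof -
  have "0 < exp (- 4 * mass * (b - a)) * (pi / (b - a))\<^sup>2"
    using a_less_b by simp
  then show ?thesis
    using E\<^sub>1_gap by linarith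
qed

lemma E\<^sub>1_le: "\<mu> \<in> excited_set \<Longrightarrow> E\<^sub>1 \<le> \<mu>"
  unfolding E\<^sub>1_def using excited_set_gap by (intro cInf_lower bdd_belowI)

text \<open>
  Zeros of \<open>P \<mu>\<close> cannot approach \<open>a\<close> for \<open>\<mu>\<close> in a bounded set: by \<open>P_zero_gap\<close> they stay at a fixed
  distance from it, and a compactness argument applies.
\<close>
lemma E\<^sub>1_in_excited_set: "E\<^sub>1 \<in> excited_set"
proof (rule ccontr)
  assume not_in: "E\<^sub>1 \<notin> excited_set"
  \<comment> \<open>\<open>k\<close> absorbs the exponential, so that the bound in
    \<open>P_zero_gap\<close> becomes a perfect square.\<close>
  define k where "k = exp (- 2 * mass * (b - a)) * pi"
  have "0 < k" by (simp add: k_def)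
  have k2: "exp (- 4 * mass * (b - a)) * (pi / x)\<^sup>2 = (k / x)\<^sup>2" for x
    by (simp add: k_def power_divide power_mult_distrib exp_double[symmetric])
  define s where "s = sqrt (E\<^sub>1 + 1 - E\<^sub>0)"
  have "0 < s" using E\<^sub>0_less_E\<^sub>1 by (simp add: s_def)
  \<comment> \<open>For parameters up to \<open>E\<^sub>1 + 1\<close>, a zero \<open>x\<close>
    satisfies \<open>k / (x - a) \<le> s\<close>, hence cannot lie to the left of
    \<open>c\<close>.\<close>
  define c where "c = min b (a + k / s)"
  have c: "a < c" "c \<le> b"
    using a_less_b \<open>0 < k\<close> \<open>0 < s\<close> by (auto simp: c_def)
  have zero_ge: "c \<le> x" if "E\<^sub>0 < \<mu>" "\<mu> \<le> E\<^sub>1 + 1" "x \<in> {a<..b}" "P \<mu> x = 0" for \<mu> x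
  proof -
    have "(k / (x - a))\<^sup>2 \<le> s\<^sup>2"
      using P_zero_gap[OF that(1,3,4)] that(2) E\<^sub>0_less_E\<^sub>1 unfolding k2 by (simp add: s_def)
    then have "k / (x - a) \<le> s"
      using \<open>0 < s\<close> power2_le_imp_le[of "k / (x - a)" s] by simp
    then have "k / s \<le> x - a"
      using \<open>0 < s\<close> that(3) by (simp add: field_simps)
    then show ?thesis
      by (simp add: c_def)
  qed
  have "continuous_on {c..b} (\<lambda>x. \<bar>P E\<^sub>1 x\<bar>)"
    using c by (intro continuous_intros continuous_on_subset[OF continuous_on_P]) auto
  from continuous_attains_inf[OF compact_Icc _ this] c
  obtain m where m: "m \<in> {c..b}" "\<And>x. x \<in> {c..b} \<Longrightarrow> \<bar>P E\<^sub>1 m\<bar> \<le> \<bar>P E\<^sub>1 x\<bar>"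
    by auto
  have "P E\<^sub>1 m \<noteq> 0"
    using not_in m(1) c E\<^sub>0_less_E\<^sub>1 by (auto simp: excited_set_def)
  then have "0 < \<bar>P E\<^sub>1 m\<bar>" by simp
  then obtain d where d: "0 < d" "\<And>\<nu> x. dist \<nu> E\<^sub>1 < d \<Longrightarrow> x \<in> {a..b} \<Longrightarrow> \<bar>P \<nu> x - P E\<^sub>1 x\<bar> < \<bar>P E\<^sub>1 m\<bar>"
    using P_eventually_close unfolding eventually_nhds_metric by metis
  \<comment> \<open>Members of the set arbitrarily close to the infimum have a zero in
    \<open>[c, b]\<close>, whereas \<open>\<bar>P E\<^sub>1 x\<bar>\<close> has a positive minimum
    there.\<close>
  have "Inf excited_set < E\<^sub>1 + min d 1"
    using d(1) by (simp add: E\<^sub>1_def)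
  then obtain \<nu> where \<nu>: "\<nu> \<in> excited_set" "\<nu> < E\<^sub>1 + min d 1"
    using cInf_lessD[OF excited_set_nonempty] by blast
  then obtain x where x: "E\<^sub>0 < \<nu>" "x \<in> {a<..b}" "P \<nu> x = 0"
    by (auto simp: excited_set_def)
  have "c \<le> x"
    using zero_ge[OF x(1) _ x(2,3)] \<nu>(2) by simp
  then have "\<bar>P E\<^sub>1 m\<bar> \<le> \<bar>P E\<^sub>1 x\<bar>"
    using m(2) x(2) by simp
  moreover have "\<bar>P \<nu> x - P E\<^sub>1 x\<bar> < \<bar>P E\<^sub>1 m\<bar>"
    using d(2)[of \<nu> x] x(2) \<nu> E\<^sub>1_le[OF \<nu>(1)] by (auto simp: dist_real_def)
  ultimately show False
    using x(3) by simp
qed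

text \<open>At \<open>a\<close> both solutions equal 1, so \<open>P\<close> starts from 0 with the
  slope \<open>- (\<mu> - E\<^sub>0)\<close>, which is negative.\<close>

lemma P_negative_near_a:
  assumes "E\<^sub>0 < \<mu>" "a < z" "z \<le> b"
  obtains x where "x \<in> {a<..<z}" "P \<mu> x < 0"
proof -
  have a: "a \<in> {a..b}" using a_less_b by simp
  have "(P \<mu> has_real_derivative - (\<mu> - E\<^sub>0)) (at a within {a..b})"
    using P_has_derivative[OF a, of \<mu>] by (simp add: W_def)
  then obtain d where d: "0 < d" "\<And>h. 0 < h \<Longrightarrow> a + h \<in> {a..b} \<Longrightarrow> h < d \<Longrightarrow> P \<mu> (a + h) < P \<mu> a"
    using has_real_derivative_neg_dec_right[of "P \<mu>" "- (\<mu> - E\<^sub>0)" a "{a..b}"] assms(1) by auto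
  define h where "h = min d (z - a) / 2"
  have "0 < h" "h < d" "h < z - a"
    using d(1) assms by (auto simp: h_def min_def field_simps)
  then show thesis
    using that[of "a + h"] d(2)[of h] assms by (simp add: P_a)
qed

text \<open>
  An interior zero of \<open>P E\<^sub>1\<close> would be simple, so \<open>P\<close> would change sign and keep a zero for
  slightly smaller \<open>\<mu>\<close>.
\<close>
lemma E\<^sub>1_neumann: "Y E\<^sub>1 b = 0"
proof -
  obtain c where c: "c \<in> {a<..b}" "P E\<^sub>1 c = 0"
    using E\<^sub>1_in_excited_set by (auto simp: excited_set_def)
  have "c = b"
  proof (rule ccontr)
    assume "c \<noteq> b"
    then have "a < c" "c < b" and c': "c \<in> {a..b}" using c by auto
    let ?l = "- (E\<^sub>1 - E\<^sub>0) * (U E\<^sub>0 c)\<^sup>2 * W E\<^sub>1 c"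
    have "W E\<^sub>1 c \<noteq> 0"
      using W_zero_imp_P_nonzero[OF c'] c(2) by blast
    then consider "0 < ?l" | "?l < 0"
      using ground_state_pos[OF c'] E\<^sub>0_less_E\<^sub>1 by (fastforce simp: linorder_neq_iff)
    \<comment> \<open>At a simple zero \<open>P E\<^sub>1\<close> becomes positive on one side: to
      the right if its slope is positive, to the left if it is negative.\<close>
    then obtain z where z: "z \<in> {a<..<b}" "0 < P E\<^sub>1 z"
    proof cases
      case 1
      then obtain d where d: "0 < d" "\<And>h. 0 < h \<Longrightarrow> c + h \<in> {a..b} \<Longrightarrow> h < d \<Longrightarrow> P E\<^sub>1 c < P E\<^sub>1 (c + h)"
        using has_real_derivative_pos_inc_right[OF P_has_derivative[OF c']] by blast
      define h where "h = min d (b - c) / 2"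
      have "0 < h" "h < d" "h < b - c"
        using d(1) \<open>c < b\<close> by (auto simp: h_def min_def field_simps)
      then show thesis
        using that[of "c + h"] d(2)[of h] \<open>a < c\<close> c(2) by simp
    next
      case 2
      then obtain d where d: "0 < d" "\<And>h. 0 < h \<Longrightarrow> c - h \<in> {a..b} \<Longrightarrow> h < d \<Longrightarrow> P E\<^sub>1 c < P E\<^sub>1 (c - h)"
        using has_real_derivative_neg_dec_left[OF P_has_derivative[OF c']] by blast
      define h where "h = min d (c - a) / 2"
      have "0 < h" "h < d" "h < c - a"
        using d(1) \<open>a < c\<close> by (auto simp: h_def min_def field_simps)
      then show thesis
        using that[of "c - h"] d(2)[of h] \<open>c < b\<close> c(2) by simp
    qed
    obtain d where d: "0 < d" "\<And>\<nu> x. dist \<nu> E\<^sub>1 < d \<Longrightarrow> x \<in> {a..b} \<Longrightarrow> \<bar>P \<nu> x - P E\<^sub>1 x\<bar> < P E\<^sub>1 z"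
      using P_eventually_close[OF z(2), of E\<^sub>1] unfolding eventually_nhds_metric by metis
    define \<nu> where "\<nu> = E\<^sub>1 - min d (E\<^sub>1 - E\<^sub>0) / 2"
    have \<nu>: "E\<^sub>0 < \<nu>" "\<nu> < E\<^sub>1" "dist \<nu> E\<^sub>1 < d"
      using d(1) E\<^sub>0_less_E\<^sub>1 by (auto simp: \<nu>_def dist_real_def min_def field_simps)
    have "0 < P \<nu> z"
      using d(2)[OF \<nu>(3), of z] z(1) by auto
    \<comment> \<open>For the smaller parameter \<open>P\<close> is still negative near
      \<open>a\<close> and positive at \<open>z\<close>, so it has a zero in between, contradicting
      the minimality of \<open>E\<^sub>1\<close>.\<close>
    moreover obtain x where x: "x \<in> {a<..<z}" "P \<nu> x < 0"
      using P_negative_near_a[OF \<nu>(1), of z] z(1) by auto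
    moreover have "continuous_on {x..z} (P \<nu>)"
      using x z by (intro continuous_on_subset[OF continuous_on_P]) auto
    ultimately obtain t where "x \<le> t" "t \<le> z" "P \<nu> t = 0"
      using IVT'[of "P \<nu>" x 0 z] by auto
    then have "\<nu> \<in> excited_set"
      using \<nu>(1) x(1) z(1) unfolding excited_set_def by (auto intro!: bexI[of _ t])
    then show False
      using E\<^sub>1_le \<nu>(2) by fastforce
  qed
  then show ?thesis
    using c(2) P_b[of E\<^sub>1] ground_state_pos[of b] a_less_b by simp
qed

text \<open>The Neumann condition at \<open>b\<close> makes \<open>P\<close> vanish at
  \<open>b\<close>, so an eigenvalue above \<open>E\<^sub>0\<close> lies in
  \<open>excited_set\<close>.\<close>

lemma neumann_eigenvalue_cases:
  assumes "Y \<mu> b = 0"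
  shows "\<mu> = E\<^sub>0 \<or> E\<^sub>1 \<le> \<mu>"
proof (rule ccontr)
  assume "\<not> ?thesis"
  then have "\<mu> < E\<^sub>0 \<or> E\<^sub>0 < \<mu> \<and> \<mu> \<notin> excited_set"
    using E\<^sub>1_le by fastforce
  then show False
    using assms no_eigenvalue_below_E\<^sub>0 P_b[of \<mu>] a_less_b by (auto simp: excited_set_def)
qed

end

section \<open>Eigenvalues of the Neumann operator\<close>

text \<open>On a bounded interval \<open>1 + (cmod (g x))\<^sup>2\<close> is an integrable majorant
  of \<open>cmod (g x)\<close>.\<close>

lemma square_integrable_on_imp_set_integrable:
  assumes "square_integrable_on {a..b} g"
  shows "set_integrable lebesgue {a..b} g"
proof -
  have "set_integrable lebesgue {a..b} (\<lambda>_. 1::real)"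
    by (intro absolutely_integrable_on_const lmeasurable_interval)
  then have "set_integrable lebesgue {a..b} (\<lambda>x. 1 + (cmod (g x))\<^sup>2)"
    using assms unfolding square_integrable_on_def by (intro set_integral_add) auto
  then show ?thesis
  proof (rule set_integrable_bound)
    show "set_borel_measurable lebesgue {a..b} g"
      using assms unfolding square_integrable_on_def by blast
    have "cmod (g x) \<le> norm (1 + (cmod (g x))\<^sup>2)" for x
    proof -
      have "0 \<le> (cmod (g x) - 1)\<^sup>2" by simp
      then show ?thesis
        using norm_ge_zero[of "g x"] zero_le_power2[of "cmod (g x)"]
        by (simp add: power2_diff abs_if)
    qed
    then show "AE x in lebesgue. x \<in> {a..b} \<longrightarrow> cmod (g x) \<le> norm (1 + (cmod (g x))\<^sup>2)"
      by simp
  qed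
qed

lemma has_H1_derivative_imp_primitive_on:
  assumes "has_H1_derivative a b f g"
  shows "primitive_on a b f g"
  unfolding primitive_on_def
proof (intro conjI ballI)
  have g: "set_integrable lebesgue {a..b} g"
    using assms square_integrable_on_imp_set_integrable unfolding has_H1_derivative_def by blast
  then show "g integrable_on {a..b}"
    by (rule set_lebesgue_integral_eq_integral)
  fix x assume x: "x \<in> {a..b}"
  then have "set_integrable lebesgue {a..x} g"
    by (intro set_integrable_subset[OF g]) auto
  then have "(LINT t:{a..x}|lebesgue. g t) = integral {a..x} g"
    by (rule set_lebesgue_integral_eq_integral)
  moreover have "f x = f a + (LINT t:{a..x}|lebesgue. g t)"
    using assms x unfolding has_H1_derivative_def by blast
  ultimately show "f x - f a = integral {a..x} g"
    by simp
qed

text \<open>Boundedness replaces square integrability on a bounded interval, and all derivatives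
  built from shooting solutions are bounded.\<close>

lemma primitive_on_imp_has_H1_derivative:
  fixes f g :: "real \<Rightarrow> complex"
  assumes fg: "primitive_on a b f g" and B: "\<And>x. x \<in> {a..b} \<Longrightarrow> norm (g x) \<le> B"
  shows "has_H1_derivative a b f g"
  unfolding has_H1_derivative_def square_integrable_on_def
proof (intro conjI ballI)
  have g: "g absolutely_integrable_on {a..b}"
    using fg B by (intro absolutely_integrable_integrable_bound[where g = "\<lambda>_. B"])
      (auto simp: primitive_on_def)
  then show meas: "set_borel_measurable lebesgue {a..b} g"
    unfolding set_integrable_def set_borel_measurable_def by (rule borel_measurable_integrable)
  show "set_integrable lebesgue {a..b} (\<lambda>x. (cmod (g x))\<^sup>2)"
  proof (rule set_integrable_bound)
    show "set_integrable lebesgue {a..b} (\<lambda>_. B\<^sup>2)"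
      by (intro absolutely_integrable_on_const lmeasurable_interval)
    have "(\<lambda>x. (norm (indicat_real {a..b} x *\<^sub>R g x))\<^sup>2) \<in> borel_measurable lebesgue"
      using meas unfolding set_borel_measurable_def by measurable
    also have "(\<lambda>x. (norm (indicat_real {a..b} x *\<^sub>R g x))\<^sup>2) = (\<lambda>x. indicat_real {a..b} x *\<^sub>R (cmod (g x))\<^sup>2)"
      by (auto simp: indicator_def)
    finally show "set_borel_measurable lebesgue {a..b} (\<lambda>x. (cmod (g x))\<^sup>2)"
      unfolding set_borel_measurable_def .
    show "AE x in lebesgue. x \<in> {a..b} \<longrightarrow> norm ((cmod (g x))\<^sup>2) \<le> norm (B\<^sup>2)"
      using B by (auto intro!: power_mono)
  qed
  fix x assume x: "x \<in> {a..b}"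
  then have "set_integrable lebesgue {a..x} g"
    by (intro set_integrable_subset[OF g]) auto
  then have "(LINT t:{a..x}|lebesgue. g t) = integral {a..x} g"
    by (rule set_lebesgue_integral_eq_integral)
  then show "f x = f a + (LINT t:{a..x}|lebesgue. g t)"
    using primitive_on_eq[OF fg x] by simp
qed

lemma primitive_on_linear:
  assumes Ff: "primitive_on a b F f" and h: "bounded_linear h"
  shows "primitive_on a b (\<lambda>x. h (F x)) (\<lambda>x. h (f x))"
  unfolding primitive_on_def
proof (intro conjI ballI)
  show "(\<lambda>x. h (f x)) integrable_on {a..b}"
    using integrable_linear[OF _ h, of f "{a..b}"] Ff by (simp add: primitive_on_def o_def)
  fix x assume x: "x \<in> {a..b}"
  have "h (F x) - h (F a) = h (integral {a..x} f)"
    using Ff x by (simp add: primitive_on_def linear_diff[OF bounded_linear.linear[OF h], symmetric])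
  also have "\<dots> = integral {a..x} (\<lambda>x. h (f x))"
    using integral_linear[OF primitive_on_integrable[OF Ff] h, of a x] x by (simp add: o_def)
  finally show "h (F x) - h (F a) = integral {a..x} (\<lambda>x. h (f x))" .
qed

text \<open>This turns the eigenvalue equation, which holds only almost everywhere, into an exact
  integrated equation.\<close>

lemma primitive_on_spike:
  assumes Ff: "primitive_on a b F f" and N: "negligible N"
    and eq: "\<And>x. x \<in> {a..b} - N \<Longrightarrow> g x = f x"
  shows "primitive_on a b F g"
  unfolding primitive_on_def
proof (intro conjI ballI)
  show "g integrable_on {a..b}"
    using Ff by (intro integrable_spike[OF _ N eq]) (auto simp: primitive_on_def)
  fix x assume x: "x \<in> {a..b}"
  have "integral {a..x} f = integral {a..x} g"
    using x by (intro integral_spike[OF N] eq) auto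
  then show "F x - F a = integral {a..x} g"
    using Ff x by (simp add: primitive_on_def)
qed

text \<open>Two versions of the potential are kept apart: the operator is formed with
  \<open>v\<^sub>0\<close>, the shooting solutions with the bounded representative
  \<open>v\<close>.\<close>

locale neumann_operator = schroedinger_interval v a b C
  for v :: "real \<Rightarrow> real" and a b C :: real +
  fixes v\<^sub>0 :: "real \<Rightarrow> real" and L :: real
  assumes v\<^sub>0_eq: "AE x in lebesgue. v\<^sub>0 x = v x"
    and endpoints: "- L / 2 = a" "L / 2 = b"
begin

section \<open>Eigenspaces spanned by the shooting solution\<close>

definition eigenfun :: "real \<Rightarrow> real \<Rightarrow> complex" where
  "eigenfun \<mu> x = (if x \<in> {a..b} then complex_of_real (U \<mu> x) else 0)"

lemma eigenfun_nonzero: "eigenfun \<mu> \<noteq> 0"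
proof -
  have "eigenfun \<mu> a = 1"
    using a_less_b by (simp add: eigenfun_def)
  then show ?thesis
    by (metis zero_fun_apply zero_neq_one)
qed

text \<open>An eigenfunction has slope 0 at \<open>a\<close>, so by uniqueness it is
  \<open>f a\<close> times the shooting solution. Its Neumann condition at \<open>b\<close> then
  gives the alternative for \<open>c\<close>.\<close>

lemma eigenspace_scale:
  assumes "f \<in> eigenspace v\<^sub>0 L \<mu>"
  obtains c where "f = scale_fun c (eigenfun \<mu>)" "c = 0 \<or> Y \<mu> b = 0"
proof -
  obtain f' f'' where outside: "\<And>x. x \<notin> {a..b} \<Longrightarrow> f x = 0"
    and H: "has_H1_derivative a b f f'" "has_H1_derivative a b f' f''"
    and bc: "f' a = 0" "f' b = 0"
    and ae: "AE x in lebesgue. x \<in> {a<..<b} \<longrightarrow> complex_of_real \<mu> * f x = - f'' x + complex_of_real (v\<^sub>0 x) * f x"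
    using assms unfolding eigenspace_def neumann_schroedinger_def endpoints by auto
  have "AE x in lebesgue. x \<in> {a<..<b} \<longrightarrow> (v x - \<mu>) *\<^sub>R f x = f'' x"
    using ae v\<^sub>0_eq by eventually_elim (auto simp: scaleR_conv_of_real algebra_simps)
  then obtain N where N: "\<And>x. x \<notin> N \<Longrightarrow> x \<in> {a<..<b} \<Longrightarrow> (v x - \<mu>) *\<^sub>R f x = f'' x"
    "N \<in> null_sets lebesgue"
    by (elim AE_E3) auto
  have "primitive_on a b f' (\<lambda>x. (v x - \<mu>) *\<^sub>R f x)"
  proof (rule primitive_on_spike[OF has_H1_derivative_imp_primitive_on[OF H(2)]])
    \<comment> \<open>The eigenvalue equation is given only on the open interval, so the endpoints
      join the exceptional set.\<close>
    show "negligible (N \<union> {a, b})"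
      using N(2) by (intro negligible_Un) (auto simp: negligible_iff_null_sets)
    show "(v x - \<mu>) *\<^sub>R f x = f'' x" if "x \<in> {a..b} - (N \<union> {a, b})" for x
      using that by (intro N(1)) auto
  qed
  with has_H1_derivative_imp_primitive_on[OF H(1)]
  have s1: "solves a b (\<lambda>x. v x - \<mu>) f f'"
    by (simp add: solves_def)
  define c where "c = f a"
  have h: "bounded_linear (\<lambda>r. c * complex_of_real r)"
    by (intro bounded_linear_intros bounded_linear_of_real)
  have s2: "solves a b (\<lambda>x. v x - \<mu>) (\<lambda>x. c * complex_of_real (U \<mu> x)) (\<lambda>x. c * complex_of_real (Y \<mu> x))"
    using primitive_on_linear[OF U_primitive h, of \<mu>] primitive_on_linear[OF Y_primitive h, of \<mu>]
    by (simp add: solves_def scaleR_conv_of_real mult_ac)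
  have eq: "f x = c * complex_of_real (U \<mu> x)" "f' x = c * complex_of_real (Y \<mu> x)" if "x \<in> {a..b}" for x
    using solves_unique[OF s1 s2 _ _ potential_bound that] bc by (simp_all add: c_def)
  show thesis
  proof (rule that)
    show "f = scale_fun c (eigenfun \<mu>)"
      using eq(1) outside by (auto simp: eigenfun_def)
    show "c = 0 \<or> Y \<mu> b = 0"
      using eq(2)[of b] bc a_less_b by auto
  qed
qed

lemma scale_in_eigenspace:
  assumes "c = 0 \<or> Y \<mu> b = 0"
  shows "scale_fun c (eigenfun \<mu>) \<in> eigenspace v\<^sub>0 L \<mu>"
proof -
  have h: "bounded_linear (\<lambda>r. c * complex_of_real r)"
    by (intro bounded_linear_intros bounded_linear_of_real)
  let ?f = "scale_fun c (eigenfun \<mu>)" and ?f' = "\<lambda>x. c * complex_of_real (Y \<mu> x)"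
    and ?f'' = "\<lambda>x. c * complex_of_real ((v x - \<mu>) * U \<mu> x)"
  obtain M where M: "\<And>x. x \<in> {a..b} \<Longrightarrow> norm (Y \<mu> x) \<le> M"
    using continuous_on_Icc_bounded[OF continuous_on_Y] by metis
  obtain B where B: "\<And>x. x \<in> {a..b} \<Longrightarrow> \<bar>(v x - \<mu>) * U \<mu> x\<bar> \<le> B"
    using Y_integrand_bounded by metis
  have "has_H1_derivative a b ?f ?f'"
  proof (rule primitive_on_imp_has_H1_derivative)
    show "primitive_on a b ?f ?f'"
      by (rule primitive_on_cong[OF primitive_on_linear[OF U_primitive h, of \<mu>]])
        (use a_less_b in \<open>auto simp: eigenfun_def\<close>)
    show "cmod (?f' x) \<le> cmod c * M" if "x \<in> {a..b}" for x
      using M[OF that] by (simp add: norm_mult mult_left_mono)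
  qed
  moreover have "has_H1_derivative a b ?f' ?f''"
  proof (rule primitive_on_imp_has_H1_derivative[OF primitive_on_linear[OF Y_primitive h, of \<mu>]])
    show "cmod (?f'' x) \<le> cmod c * B" if "x \<in> {a..b}" for x
      unfolding norm_mult norm_of_real using B[OF that] by (intro mult_left_mono) auto
  qed
  moreover have "AE x in lebesgue. x \<in> {a<..<b} \<longrightarrow>
      complex_of_real \<mu> * ?f x = - ?f'' x + complex_of_real (v\<^sub>0 x) * ?f x"
    using v\<^sub>0_eq by eventually_elim (auto simp: eigenfun_def algebra_simps)
  moreover have "?f x = 0" if "x \<notin> {a..b}" for x
    using that by (auto simp: eigenfun_def)
  moreover have "?f' a = 0" "?f' b = 0"
    using assms Y_a by auto
  ultimately show ?thesis
    unfolding eigenspace_def neumann_schroedinger_def endpoints by blast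
qed

lemma is_eigenvalue_iff: "is_eigenvalue v\<^sub>0 L \<mu> \<longleftrightarrow> Y \<mu> b = 0"
proof
  assume "is_eigenvalue v\<^sub>0 L \<mu>"
  then obtain f where f: "f \<in> eigenspace v\<^sub>0 L \<mu>" "f \<noteq> 0"
    unfolding is_eigenvalue_def by blast
  obtain c where c: "f = scale_fun c (eigenfun \<mu>)" "c = 0 \<or> Y \<mu> b = 0"
    using eigenspace_scale[OF f(1)] by blast
  then show "Y \<mu> b = 0"
    using f(2) by (auto simp: fun_eq_iff)
next
  assume "Y \<mu> b = 0"
  then have "scale_fun 1 (eigenfun \<mu>) \<in> eigenspace v\<^sub>0 L \<mu>"
    by (intro scale_in_eigenspace) simp
  then show "is_eigenvalue v\<^sub>0 L \<mu>"
    using eigenfun_nonzero[of \<mu>] unfolding is_eigenvalue_def by auto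
qed

lemma multiplicity_one:
  assumes "Y \<mu> b = 0"
  shows "eigenvalue_multiplicity v\<^sub>0 L \<mu> = 1"
proof -
  interpret fs: vector_space scale_fun
    by (rule vector_space_scale_fun)
  have "eigenspace v\<^sub>0 L \<mu> = fs.span {eigenfun \<mu>}"
    unfolding fs.span_singleton
    using eigenspace_scale[of _ \<mu>] scale_in_eigenspace[of _ \<mu>] assms by blast
  moreover have "fs.independent {eigenfun \<mu>}"
    using eigenfun_nonzero by simp
  ultimately show ?thesis
    unfolding eigenvalue_multiplicity_def by (simp add: fs.dim_eq_card_independent)
qed

text \<open>Every summand is 1. For an infinite index set both sides would be 0 by
  convention.\<close>

lemma eigenvalue_count_eq: "eigenvalue_count v\<^sub>0 L \<mu> = card {l. Y l b = 0 \<and> l \<le> \<mu>}"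
  unfolding eigenvalue_count_def is_eigenvalue_iff by (simp add: multiplicity_one)

text \<open>For a lower bound on the gap, an upper estimate of the lowest eigenvalue suffices. The
  infimum of reals needs a lower bound of the set, and \<open>E\<^sub>0\<close> is one because the
  count below it is 0.\<close>

lemma eigenvalue_0_le: "eigenvalue v\<^sub>0 L 0 \<le> E\<^sub>0"
  unfolding eigenvalue_def
proof (rule cInf_lower)
  have "{l. Y l b = 0 \<and> l \<le> E\<^sub>0} = {E\<^sub>0}"
    using neumann_eigenvalue_cases E\<^sub>0_less_E\<^sub>1 ground_state_neumann by fastforce
  then show "E\<^sub>0 \<in> {\<mu>. 0 + 1 \<le> eigenvalue_count v\<^sub>0 L \<mu>}"
    by (simp add: eigenvalue_count_eq)
  show "bdd_below {\<mu>. 0 + 1 \<le> eigenvalue_count v\<^sub>0 L \<mu>}"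
  proof (rule bdd_belowI)
    fix \<mu> assume "\<mu> \<in> {\<mu>. 0 + 1 \<le> eigenvalue_count v\<^sub>0 L \<mu>}"
    then have "{l. Y l b = 0 \<and> l \<le> \<mu>} \<noteq> {}"
      unfolding eigenvalue_count_eq by (metis (mono_tags) One_nat_def add_0 card.empty mem_Collect_eq not_one_le_zero)
    then show "E\<^sub>0 \<le> \<mu>"
      using neumann_eigenvalue_cases E\<^sub>0_less_E\<^sub>1 by fastforce
  qed
qed

text \<open>Below \<open>E\<^sub>1\<close> at most the single eigenvalue \<open>E\<^sub>0\<close> is
  counted. At \<open>E\<^sub>1\<close> the count is exactly 2, which makes the set under the infimum
  nonempty.\<close>

lemma eigenvalue_1_ge: "E\<^sub>1 \<le> eigenvalue v\<^sub>0 L 1"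
  unfolding eigenvalue_def
proof (rule cInf_greatest)
  have "{l. Y l b = 0 \<and> l \<le> E\<^sub>1} = {E\<^sub>0, E\<^sub>1}"
    using neumann_eigenvalue_cases E\<^sub>0_less_E\<^sub>1 ground_state_neumann E\<^sub>1_neumann by fastforce
  then have "E\<^sub>1 \<in> {\<mu>. 1 + 1 \<le> eigenvalue_count v\<^sub>0 L \<mu>}"
    using E\<^sub>0_less_E\<^sub>1 by (simp add: eigenvalue_count_eq)
  then show "{\<mu>. 1 + 1 \<le> eigenvalue_count v\<^sub>0 L \<mu>} \<noteq> {}"
    by blast
  fix \<mu> assume \<mu>: "\<mu> \<in> {\<mu>. 1 + 1 \<le> eigenvalue_count v\<^sub>0 L \<mu>}"
  show "E\<^sub>1 \<le> \<mu>"
  proof (rule ccontr)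
    assume "\<not> E\<^sub>1 \<le> \<mu>"
    then have "{l. Y l b = 0 \<and> l \<le> \<mu>} \<subseteq> {E\<^sub>0}"
      using neumann_eigenvalue_cases by fastforce
    then have "card {l. Y l b = 0 \<and> l \<le> \<mu>} \<le> 1"
      using card_mono[of "{E\<^sub>0}"] by fastforce
    then show False
      using \<mu> by (simp add: eigenvalue_count_eq)
  qed
qed

lemma spectral_gap_ge: "exp (- 4 * mass * L) * (pi / L)\<^sup>2 \<le> spectral_gap v\<^sub>0 L"
proof -
  have "b - a = L"
    using endpoints by simp
  then show ?thesis
    using E\<^sub>1_gap eigenvalue_0_le eigenvalue_1_ge by (simp add: spectral_gap_def)
qed

end

section \<open>Transfer to an essentially bounded potential\<close>

theorem theorem2p4:
  fixes v :: "real \<Rightarrow> real" and L :: real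
  assumes "essentially_bounded v"
    and "AE x in lebesgue. 0 \<le> v x"
    and "L > 0"
  shows "spectral_gap v L \<ge>
           exp (- 8 * L * (LINT x:{-L/2<..<L/2}|lebesgue. \<bar>v x\<bar>)) * (pi\<^sup>2 / L\<^sup>2)"
proof -
  obtain C where C: "AE x in lebesgue. \<bar>v x\<bar> \<le> C" and v_meas: "v \<in> borel_measurable lebesgue"
    using assms(1) unfolding essentially_bounded_def by blast
  \<comment> \<open>Truncation to \<open>[0, \<bar>C\<bar>]\<close> makes the bounds hold everywhere
    and changes \<open>v\<close> only on a null set; the absolute value ensures that the upper bound
    is nonnegative.\<close>
  define u where "u x = max 0 (min \<bar>C\<bar> (v x))" for x
  have u_eq: "AE x in lebesgue. v x = u x"
    using C assms(2) by eventually_elim (auto simp: u_def)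
  have u_meas: "u \<in> borel_measurable lebesgue"
    unfolding u_def using v_meas by measurable
  interpret neumann_operator u "- L / 2" "L / 2" "\<bar>C\<bar>" v L
  proof
    show "- L / 2 < L / 2"
      using \<open>L > 0\<close> by simp
    show "u \<in> borel_measurable (lebesgue_on {- L / 2..L / 2})"
      using u_meas by (rule measurable_restrict_space1)
    show "AE x in lebesgue. v x = u x"
      by (fact u_eq)
  qed (auto simp: u_def)
  have "(LINT x:{-L/2<..<L/2}|lebesgue. \<bar>v x\<bar>) = (LINT x:{-L/2<..<L/2}|lebesgue. u x)"
  proof (rule set_lebesgue_integral_cong_AE)
    show "AE x\<in>{-L/2<..<L/2} in lebesgue. \<bar>v x\<bar> = u x"
      using u_eq assms(2) by eventually_elim auto
  qed (use u_meas v_meas in auto)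
  also have "\<dots> = integral {-L/2<..<L/2} u"
  proof (rule set_lebesgue_integral_eq_integral)
    have "u absolutely_integrable_on {-L/2..L/2}"
      using v_integrable v_nonneg by (intro nonnegative_absolutely_integrable_1) auto
    then show "set_integrable lebesgue {-L/2<..<L/2} u"
      by (rule set_integrable_subset) auto
  qed
  also have "\<dots> = mass"
    unfolding mass_def by (simp only: integral_open_interval_real)
  finally have "(LINT x:{-L/2<..<L/2}|lebesgue. \<bar>v x\<bar>) = mass" .
  \<comment> \<open>The exponent obtained, \<open>- 4 * mass * L\<close>, is at least the claimed
    one because \<open>mass\<close> and \<open>L\<close> are nonnegative.\<close>
  then have "exp (- 8 * L * (LINT x:{-L/2<..<L/2}|lebesgue. \<bar>v x\<bar>)) * (pi\<^sup>2 / L\<^sup>2)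
      \<le> exp (- 4 * mass * L) * (pi / L)\<^sup>2"
    using \<open>L > 0\<close> mass_nonneg by (simp add: power_divide divide_right_mono)
  also have "\<dots> \<le> spectral_gap v L"
    by (rule spectral_gap_ge)
  finally show ?thesis .
qed

end
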